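(* Let $X^N_t$ be a continuous-time Markov chain with finite strongly connected transition graph $(V,E)$ and positive rates $r_N$ satisfying Assumption (A) (stated in the context), and let $\pi_N$ be its unique invariant probability measure. Let $\mathcal M$ be the set of minimal fast classes, $\hat V=\bigcup_{M\in\mathcal M}M$, and let $\mu_M$ ($M\in\mathcal M$) and $\bar\pi$ be the limiting measures defined in the context. Then $\pi:=\lim_{N\to\infty}\pi_N$ exists, is a probability measure on $V$, and $$\pi=\sum_{M\in\mathcal M}\bar\pi(M)\,\mu_M .$$ In particular $\pi(x)=0$ for every $x\in V\setminus\hat V$; explicitly, $\pi(x)=\bar\pi(M)\,\mu_M(x)$ if $x\in M$ with $M\in\mathcal M$, and $\pi(x)=0$ if $x$ belongs to a fast class that is not minimal.
   Context: Setting. $(V,E)$ is a finite strongly connected directed graph; for every $N>0$ each edge $(x,y)\in E$ has a weight $r_N(x,y)>0$, and $r_N(x,y)=0$ if $(x,y)\notin E$. $X^N_t$ is the continuous-time Markov chain on $V$ with jump rates $r_N$. An invariant measure is a probability measure $\pi_N$ with $\pi_N(x)\sum_y r_N(x,y)=\sum_y\pi_N(y)r_N(y,x)$ for all $x$. Assumption (A): for every pair of families of non-negative integers $(m_e)_{e\in E}$, $(n_e)_{e\in E}$ with $\sum_e m_e=\sum_e n_e$, the limit $\lim_{N\to\infty}\prod_{e\in E}r_N(e)^{m_e}\big/\prod_{e\in E}r_N(e)^{n_e}$ exists in $[0,\infty]$. Fast edges: $E_F$ is the set of $e\in E$ such that $\lim_N r_N(e')/r_N(e)<\infty$ for all $e'\in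 E$. Fast classes: the equivalence classes of $V$ under mutual reachability by directed paths (possibly of length zero) in $(V,E_F)$. A fast class $M$ is minimal if no edge of $E_F$ goes from $M$ to $V\setminus M$. $\mathcal M$ is the set of minimal fast classes and $\hat V=\bigcup_{M\in\mathcal M}M$. $E_F[M]$ is the set of edges of $E_F$ with both endpoints in $M$. Reduced (trace) rates: for $x\ne y$ in $\hat V$, $\hat r_N(x,y)=r_N(x,y)+\sum_{z\in V\setminus\hat V}r_N(x,z)P_N^{\hat V}(y\,|\,z)$, where $P_N^{\hat V}(y\,|\,z)$ is the probability that $X^N_t$ started at $z$ first enters $\hat V$ at $y$. Fast invariant measures: for $M\in\mathcal M$, $\mu^N_M$ is the unique invariant probability measure of the Markov chain with (strongly connected) transition graph $(M,E_F[M])$ and rates $r_N$; $\mu_M:=\lim_{N\to\infty}\mu^N_M$ (this limit exists), regarded as a measure on $V$ supported on $M$. Effective rates: for $M_1\neq M_2$ in $\mathcal M$, $\bar r_N(M_1,M_2)=\sum_{y_1\in M_1,\,y_2\in M_2}\mu^N_{M_1}(y_1)\,\hat r_N(y_1,y_2)$. The chain on $\mathcal M$ with rates $\bar r_N$ is irreducible; $\bar\pi_N$ is its unique invariant probability measure and $\bar\pi:=\lim_{N\to\infty}\bar\pi_N$ (this limit exists). *)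

theory Defs
  imports "HOL-Probability.Probability"
begin

section \<open>Invariant measures of finite Markov chains\<close>

text \<open>A continuous-time chain on a finite set \<open>V\<close> is given by its jump rates \<open>r x y\<close>.
  Probability measures on a finite set are elements of \<^typ>\<open>'v pmf\<close> whose support lies in it.
  A diagonal rate \<open>r x x\<close> contributes equally to both sides of the balance equation.\<close>

definition invariant_pmf :: "'v set \<Rightarrow> ('v \<Rightarrow> 'v \<Rightarrow> real) \<Rightarrow> 'v pmf \<Rightarrow> bool" where
  "invariant_pmf V r p \<longleftrightarrow>
     set_pmf p \<subseteq> V \<and>
     (\<forall>x\<in>V. pmf p x * (\<Sum>y\<in>V. r x y) = (\<Sum>y\<in>V. pmf p y * r y x))"

definition inv_measure :: "'v set \<Rightarrow> ('v \<Rightarrow> 'v \<Rightarrow> real) \<Rightarrow> 'v pmf" where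
  "inv_measure V r = (THE p. invariant_pmf V r p)"


section \<open>The continuous-time chain and its entrance probabilities\<close>

definition exit_rate :: "'v set \<Rightarrow> ('v \<Rightarrow> 'v \<Rightarrow> real) \<Rightarrow> 'v \<Rightarrow> real" where
  "exit_rate V r x = (\<Sum>y\<in>V. r x y)"

definition jump_pmf :: "'v set \<Rightarrow> ('v \<Rightarrow> 'v \<Rightarrow> real) \<Rightarrow> 'v \<Rightarrow> 'v pmf" where
  "jump_pmf V r x = embed_pmf (\<lambda>y. if y \<in> V then r x y / exit_rate V r x else 0)"

text \<open>The chain is realised on a space of i.i.d. steps.  A step \<open>(f, \<tau>)\<close> consists of
  independent jump targets \<open>f x\<close> with law \<open>jump_pmf V r x\<close>, one for each vertex \<open>x \<in> V\<close>,
  and an independent standard exponential time \<open>\<tau>\<close>: the chain sitting at \<open>x\<close> stays there for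
  time \<open>\<tau> / exit_rate V r x\<close>, which is exponential with parameter \<open>exit_rate V r x\<close>, and then
  jumps to \<open>f x\<close>.  The completion makes subsets of null events measurable.\<close>

definition step_space :: "'v set \<Rightarrow> ('v \<Rightarrow> 'v \<Rightarrow> real) \<Rightarrow> (('v \<Rightarrow> 'v) \<times> real) measure" where
  "step_space V r =
     measure_pmf (Pi_pmf V undefined (jump_pmf V r)) \<Otimes>\<^sub>M density lborel (exponential_density 1)"

definition path_space :: "'v set \<Rightarrow> ('v \<Rightarrow> 'v \<Rightarrow> real) \<Rightarrow> (('v \<Rightarrow> 'v) \<times> real) stream measure" where
  "path_space V r = completion (stream_space (step_space V r))"

primrec jump_chain :: "'v \<Rightarrow> (('v \<Rightarrow> 'v) \<times> real) stream \<Rightarrow> nat \<Rightarrow> 'v" where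
  "jump_chain z \<omega> 0 = z"
| "jump_chain z \<omega> (Suc n) = fst (\<omega> !! n) (jump_chain z \<omega> n)"

definition jump_time ::
  "'v set \<Rightarrow> ('v \<Rightarrow> 'v \<Rightarrow> real) \<Rightarrow> 'v \<Rightarrow> (('v \<Rightarrow> 'v) \<times> real) stream \<Rightarrow> nat \<Rightarrow> real" where
  "jump_time V r z \<omega> n = (\<Sum>k<n. snd (\<omega> !! k) / exit_rate V r (jump_chain z \<omega> k))"

text \<open>\<open>chain V r z \<omega> t\<close> is the position at time \<open>t\<close> of the chain started at \<open>z\<close>.\<close>

definition chain ::
  "'v set \<Rightarrow> ('v \<Rightarrow> 'v \<Rightarrow> real) \<Rightarrow> 'v \<Rightarrow> (('v \<Rightarrow> 'v) \<times> real) stream \<Rightarrow> real \<Rightarrow> 'v" where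
  "chain V r z \<omega> t = jump_chain z \<omega> (LEAST n. t < jump_time V r z \<omega> (Suc n))"

definition entrance_prob ::
  "'v set \<Rightarrow> ('v \<Rightarrow> 'v \<Rightarrow> real) \<Rightarrow> 'v set \<Rightarrow> 'v \<Rightarrow> 'v \<Rightarrow> real" where
  "entrance_prob V r A z y =
     \<P>(\<omega> in path_space V r. \<exists>t\<ge>0. chain V r z \<omega> t \<in> A \<and> chain V r z \<omega> t = y \<and>
       (\<forall>s. 0 \<le> s \<and> s < t \<longrightarrow> chain V r z \<omega> s \<notin> A))"

text \<open>Trace and effective rates are only meaningful between distinct states; the diagonal value
  \<open>0\<close> is a convention.\<close>

definition trace_rate ::
  "'v set \<Rightarrow> ('v \<Rightarrow> 'v \<Rightarrow> real) \<Rightarrow> 'v set \<Rightarrow> 'v \<Rightarrow> 'v \<Rightarrow> real" where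
  "trace_rate V r A x y =
     (if x = y then 0 else r x y + (\<Sum>z\<in>V - A. r x z * entrance_prob V r A z y))"


section \<open>Families of rates, fast classes and effective rates\<close>

definition assumption_A :: "('v \<times> 'v) set \<Rightarrow> (nat \<Rightarrow> 'v \<Rightarrow> 'v \<Rightarrow> real) \<Rightarrow> bool" where
  "assumption_A E r \<longleftrightarrow>
     (\<forall>m n :: 'v \<times> 'v \<Rightarrow> nat. (\<Sum>e\<in>E. m e) = (\<Sum>e\<in>E. n e) \<longrightarrow>
       (\<exists>L :: ennreal.
         (\<lambda>N. ennreal ((\<Prod>(x, y)\<in>E. r N x y ^ m (x, y)) / (\<Prod>(x, y)\<in>E. r N x y ^ n (x, y))))
           \<longlonglongrightarrow> L))"

text \<open>The limit of \<open>r N x' y' / r N x y\<close> exists in \<open>[0, \<infinity>]\<close> by \<open>assumption_A\<close>; it is finite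
  iff the ratios converge in the reals.\<close>

definition fast_edges :: "('v \<times> 'v) set \<Rightarrow> (nat \<Rightarrow> 'v \<Rightarrow> 'v \<Rightarrow> real) \<Rightarrow> ('v \<times> 'v) set" where
  "fast_edges E r =
     {(x, y) \<in> E. \<forall>(x', y') \<in> E. convergent (\<lambda>N. r N x' y' / r N x y)}"

text \<open>Mutual reachability by \<open>rtrancl\<close> allows paths of length zero, so a vertex without fast
  edges forms a class of its own.\<close>

definition fast_classes ::
  "'v set \<Rightarrow> ('v \<times> 'v) set \<Rightarrow> (nat \<Rightarrow> 'v \<Rightarrow> 'v \<Rightarrow> real) \<Rightarrow> 'v set set" where
  "fast_classes V E r =
     V // {(x, y) \<in> V \<times> V. (x, y) \<in> (fast_edges E r)\<^sup>* \<and> (y, x) \<in> (fast_edges E r)\<^sup>*}"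

definition minimal_classes ::
  "'v set \<Rightarrow> ('v \<times> 'v) set \<Rightarrow> (nat \<Rightarrow> 'v \<Rightarrow> 'v \<Rightarrow> real) \<Rightarrow> 'v set set" where
  "minimal_classes V E r =
     {M \<in> fast_classes V E r. \<forall>x\<in>M. \<forall>y\<in>V - M. (x, y) \<notin> fast_edges E r}"

definition V_hat :: "'v set \<Rightarrow> ('v \<times> 'v) set \<Rightarrow> (nat \<Rightarrow> 'v \<Rightarrow> 'v \<Rightarrow> real) \<Rightarrow> 'v set" where
  "V_hat V E r = \<Union>(minimal_classes V E r)"

text \<open>\<open>mu_N E r N M\<close> belongs to the chain on \<open>M\<close> that uses only the fast edges inside \<open>M\<close>.\<close>

definition mu_N ::
  "('v \<times> 'v) set \<Rightarrow> (nat \<Rightarrow> 'v \<Rightarrow> 'v \<Rightarrow> real) \<Rightarrow> nat \<Rightarrow> 'v set \<Rightarrow> 'v pmf" where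
  "mu_N E r N M =
     inv_measure M (\<lambda>x y. if (x, y) \<in> fast_edges E r \<inter> M \<times> M then r N x y else 0)"

definition mu_lim ::
  "('v \<times> 'v) set \<Rightarrow> (nat \<Rightarrow> 'v \<Rightarrow> 'v \<Rightarrow> real) \<Rightarrow> 'v set \<Rightarrow> 'v \<Rightarrow> real" where
  "mu_lim E r M x = lim (\<lambda>N. pmf (mu_N E r N M) x)"

definition eff_rate ::
  "'v set \<Rightarrow> ('v \<times> 'v) set \<Rightarrow> (nat \<Rightarrow> 'v \<Rightarrow> 'v \<Rightarrow> real) \<Rightarrow> nat \<Rightarrow> 'v set \<Rightarrow> 'v set \<Rightarrow> real" where
  "eff_rate V E r N M1 M2 =
     (if M1 = M2 then 0
      else \<Sum>y1\<in>M1. \<Sum>y2\<in>M2.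
             pmf (mu_N E r N M1) y1 * trace_rate V (r N) (V_hat V E r) y1 y2)"

definition pi_bar_N ::
  "'v set \<Rightarrow> ('v \<times> 'v) set \<Rightarrow> (nat \<Rightarrow> 'v \<Rightarrow> 'v \<Rightarrow> real) \<Rightarrow> nat \<Rightarrow> 'v set pmf" where
  "pi_bar_N V E r N = inv_measure (minimal_classes V E r) (eff_rate V E r N)"

definition pi_bar_lim ::
  "'v set \<Rightarrow> ('v \<times> 'v) set \<Rightarrow> (nat \<Rightarrow> 'v \<Rightarrow> 'v \<Rightarrow> real) \<Rightarrow> 'v set \<Rightarrow> real" where
  "pi_bar_lim V E r M = lim (\<lambda>N. pmf (pi_bar_N V E r N) M)"

end

theory Submission
  imports Defs
begin

text \<open>Eliminating the states one at a time shows that ratios of invariant weights are obtained from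
  the rates by additions, multiplications and divisions.  Two consequences are drawn.  Under
  Assumption (A) such an expression of degree \<open>0\<close> is asymptotic to a multiple of a Laurent monomial,
  so that all the weights converge.  Moreover, rates that agree up to factors tending to \<open>1\<close> have
  invariant weights that agree up to factors tending to \<open>1\<close>.

  Dividing the rates by the rate of a fast edge gives a limit chain whose edges are the fast edges.
  The limit of \<open>\<pi>_N\<close> is invariant for it, hence lives on \<open>V_hat\<close>, and conditionally on a minimal class
  \<open>M\<close> it equals the unique (positive) invariant measure \<open>\<mu>_M\<close>.  To find the mass of \<open>M\<close>, trace the
  chain on \<open>V_hat\<close> and lump the classes: the masses \<open>\<pi>_N(M)\<close> are invariant for rates that differ from
  the effective rates only in that \<open>\<mu>\<^sup>N_M\<close> is replaced by the conditional law of \<open>\<pi>_N\<close> on \<open>M\<close>,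
  that is by factors tending to \<open>1\<close>.\<close>

section \<open>Invariant vectors of finite chains\<close>

text \<open>The rescaled limit chain has a separate invariant measure for every minimal class, so it
  cannot determine how the mass is divided among the classes. That division is decided by rates that
  vanish after rescaling, possibly at several different speeds; replacing them by limits, or
  controlling additive errors, would lose it. Relative errors are what must be controlled, and they
  survive sums, products and quotients of positive quantities but not a subtraction. This is why the
  limits \<open>mu_lim\<close> have to be positive on the whole class before quotients with them are
  formed. Assumption (A) compares only monomials of equal total degree, hence the bookkeeping of
  degrees: both consequences of elimination are instances of one abstract class of positive
  functions graded by degree. The index \<open>N = 0\<close> carries no hypothesis on the rates, so
  statements about them start at \<open>N = 1\<close>.\<close>

definition support_graph :: "'v set \<Rightarrow> ('v \<Rightarrow> 'v \<Rightarrow> real) \<Rightarrow> ('v \<times> 'v) set" where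
  "support_graph V r = {(x, y) \<in> V \<times> V. r x y > 0}"

text \<open>No sign and no normalisation is imposed, so that differences of invariant vectors are
  again invariant vectors.\<close>

definition invariant_vec :: "'v set \<Rightarrow> ('v \<Rightarrow> 'v \<Rightarrow> real) \<Rightarrow> ('v \<Rightarrow> real) \<Rightarrow> bool" where
  "invariant_vec V r p \<longleftrightarrow> (\<forall>x\<in>V. p x * (\<Sum>y\<in>V. r x y) = (\<Sum>y\<in>V. p y * r y x))"

text \<open>Positivity spreads along edges: positive inflow into a vertex must be matched by
  outflow, which is a multiple of the weight there.\<close>

lemma invariant_vec_pos:
  assumes V: "finite V" and r: "\<And>x y. x \<in> V \<Longrightarrow> y \<in> V \<Longrightarrow> 0 \<le> r x y"
    and inv: "invariant_vec V r p" and p: "\<And>x. x \<in> V \<Longrightarrow> 0 \<le> p x"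
    and path: "(x, y) \<in> (support_graph V r)\<^sup>*" and x: "p x > 0"
  shows "p y > 0"
  using path
proof (induction rule: rtrancl_induct)
  case base
  show ?case by (fact x)
next
  case (step y z)
  then have yz: "y \<in> V" "z \<in> V" "r y z > 0" by (auto simp: support_graph_def)
  have "0 < p y * r y z" using yz step by simp
  also have "\<dots> \<le> (\<Sum>y\<in>V. p y * r y z)"
    by (rule member_le_sum) (use yz V r p in auto)
  also have "\<dots> = p z * (\<Sum>y\<in>V. r z y)" using inv yz by (simp add: invariant_vec_def)
  finally show ?case using p[of z] yz by (cases "p z = 0") auto
qed

text \<open>Subtract from \<open>q\<close> the largest multiple \<open>c\<close> of \<open>p\<close>
  that stays below it. The difference is invariant, nonnegative and zero at a minimiser of
  \<open>q / p\<close>; if it were positive anywhere, positivity would spread to that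
  minimiser.\<close>

lemma invariant_vec_unique:
  assumes V: "finite V" and r: "\<And>x y. x \<in> V \<Longrightarrow> y \<in> V \<Longrightarrow> 0 \<le> r x y"
    and irr: "\<And>x y. x \<in> V \<Longrightarrow> y \<in> V \<Longrightarrow> (x, y) \<in> (support_graph V r)\<^sup>*"
    and p: "invariant_vec V r p" "\<And>x. x \<in> V \<Longrightarrow> 0 < p x"
    and q: "invariant_vec V r q" "\<And>x. x \<in> V \<Longrightarrow> 0 \<le> q x"
    and xy: "x \<in> V" "y \<in> V"
  shows "q x * p y = q y * p x"
proof -
  define c where "c = Min ((\<lambda>x. q x / p x) ` V)"
  have "c \<in> (\<lambda>x. q x / p x) ` V" unfolding c_def by (rule Min_in) (use V xy in auto)
  then obtain x0 where x0: "x0 \<in> V" "c = q x0 / p x0" by auto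
  have c: "c \<le> q x / p x" if "x \<in> V" for x unfolding c_def using that V by auto
  define d where "d x = q x - c * p x" for x
  have d0: "0 \<le> d x" if "x \<in> V" for x
    using c[OF that] p(2)[OF that] by (simp add: d_def pos_le_divide_eq)
  have "invariant_vec V r d"
    using p(1) q(1) unfolding invariant_vec_def d_def
    by (simp add: algebra_simps sum_subtractf flip: sum_distrib_left)
  moreover have "d x0 = 0" using p(2)[OF x0(1)] by (simp add: d_def x0(2))
  ultimately have "d x = 0" if "x \<in> V" for x
    using invariant_vec_pos[OF V r _ d0 irr[OF that x0(1)]] d0[OF that] by force
  then have "q x = c * p x" "q y = c * p y" using xy by (auto simp: d_def)
  then show ?thesis by simp
qed

lemma pmf_embed_finite:
  assumes V: "finite V" and p: "\<And>x. 0 \<le> p x" "\<And>x. x \<notin> V \<Longrightarrow> p x = 0" "sum p V = 1"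
  shows "pmf (embed_pmf p) x = p x"
proof (rule pmf_embed_pmf)
  have "(\<integral>\<^sup>+ x. ennreal (p x) \<partial>count_space UNIV) = (\<integral>\<^sup>+ x. ennreal (p x) \<partial>count_space V)"
    by (rule nn_integral_count_space_eq) (use p(2) in auto)
  also have "\<dots> = (\<Sum>x\<in>V. ennreal (p x))" using V by (simp add: nn_integral_count_space_finite)
  also have "\<dots> = 1" using p by (simp add: sum_ennreal)
  finally show "(\<integral>\<^sup>+ x. ennreal (p x) \<partial>count_space UNIV) = 1" .
qed (rule p)

text \<open>\<open>inv_measure\<close> is a definite description, so both existence and uniqueness
  are needed to evaluate it. One positive invariant vector supplies both.\<close>

lemma pmf_inv_measure:
  assumes V: "finite V" "V \<noteq> {}" and r: "\<And>x y. x \<in> V \<Longrightarrow> y \<in> V \<Longrightarrow> 0 \<le> r x y"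
    and irr: "\<And>x y. x \<in> V \<Longrightarrow> y \<in> V \<Longrightarrow> (x, y) \<in> (support_graph V r)\<^sup>*"
    and p: "invariant_vec V r p" "\<And>x. x \<in> V \<Longrightarrow> 0 < p x"
  shows "pmf (inv_measure V r) x = (if x \<in> V then p x / sum p V else 0)"
proof -
  have s: "0 < sum p V" using V p by (intro sum_pos) auto
  define f where "f x = (if x \<in> V then p x / sum p V else 0)" for x
  have f0: "0 \<le> f x" for x using s p(2) by (auto simp: f_def less_imp_le)
  define P where "P = embed_pmf f"
  have P: "pmf P x = f x" for x unfolding P_def
    by (rule pmf_embed_finite[OF V(1) f0]) (use s in \<open>simp_all add: f_def flip: sum_divide_distrib\<close>)
  have "invariant_pmf V r P" unfolding invariant_pmf_def
  proof (intro conjI ballI)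
    show "set_pmf P \<subseteq> V" by (auto simp: set_pmf_eq P f_def)
    fix x assume x: "x \<in> V"
    have "(\<Sum>y\<in>V. pmf P y * r y x) = (\<Sum>y\<in>V. p y * r y x) / sum p V"
      unfolding sum_divide_distrib by (rule sum.cong) (auto simp: P f_def)
    then show "pmf P x * (\<Sum>y\<in>V. r x y) = (\<Sum>y\<in>V. pmf P y * r y x)"
      using p(1) x by (simp add: invariant_vec_def P f_def)
  qed
  moreover have "Q = P" if Q: "invariant_pmf V r Q" for Q
  proof (rule pmf_eqI)
    fix x
    have Qs: "set_pmf Q \<subseteq> V" and "invariant_vec V r (pmf Q)"
      using Q by (auto simp: invariant_pmf_def invariant_vec_def)
    then have eq: "pmf Q x * p y = pmf Q y * p x" if "x \<in> V" "y \<in> V" for x y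
      using that by (intro invariant_vec_unique[OF V(1) r irr p]) auto
    show "pmf Q x = pmf P x"
    proof (cases "x \<in> V")
      case True
      have "pmf Q x * sum p V = (\<Sum>y\<in>V. pmf Q y) * p x"
        unfolding sum_distrib_left sum_distrib_right by (rule sum.cong) (use eq True in auto)
      also have "(\<Sum>y\<in>V. pmf Q y) = 1" using Qs V by (simp add: sum_pmf_eq_1)
      finally show ?thesis using True s by (simp add: P f_def field_simps)
    next
      case False
      then show ?thesis using Qs by (auto simp: P f_def set_pmf_eq)
    qed
  qed
  ultimately have "inv_measure V r = P" unfolding inv_measure_def by (intro the_equality)
  then show ?thesis by (simp add: P f_def)
qed

text \<open>Maximum principle: at a point where a positive maximum is attained, every jump must lead
  to a point of \<open>B\<close> with the same value, and following a path out of \<open>B\<close>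
  gives a contradiction.\<close>

lemma subharmonic_zero:
  assumes V: "finite V" and B: "B \<subseteq> V"
    and r: "\<And>x y. x \<in> V \<Longrightarrow> y \<in> V \<Longrightarrow> 0 \<le> r x y"
    and g0: "\<And>z. z \<in> B \<Longrightarrow> 0 \<le> g z"
    and sub: "\<And>z. z \<in> B \<Longrightarrow> g z * (\<Sum>y\<in>V. r z y) \<le> (\<Sum>w\<in>B. r z w * g w)"
    and exit: "\<And>z. z \<in> B \<Longrightarrow> \<exists>y\<in>V - B. (z, y) \<in> (support_graph V r)\<^sup>*"
    and z: "z \<in> B"
  shows "g z = 0"
proof (rule ccontr)
  assume nz: "g z \<noteq> 0"
  have fB: "finite B" using V B finite_subset by blast
  define m where "m = Max (g ` B)"
  have le: "g w \<le> m" if "w \<in> B" for w unfolding m_def using fB that by auto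
  have m0: "m > 0" using le[OF z] g0[OF z] nz by simp
  have "m \<in> g ` B" unfolding m_def using fB z by (intro Max_in) auto
  then obtain z0 where z0: "z0 \<in> B" "g z0 = m" by auto
  obtain y where y: "y \<in> V - B" "(z0, y) \<in> (support_graph V r)\<^sup>*" using exit[OF z0(1)] by auto
  have "y \<in> B \<and> g y = m" using y(2)
  proof (induction rule: rtrancl_induct)
    case base
    then show ?case using z0 by simp
  next
    case (step u w)
    then have u: "u \<in> B" "g u = m" "u \<in> V" and w: "w \<in> V" "r u w > 0"
      by (auto simp: support_graph_def)
    \<comment> \<open>Extended by \<open>0\<close>, the function lies strictly below the maximum
      \<open>m\<close> outside \<open>B\<close>, so one sum over \<open>V\<close> excludes both
      leaving \<open>B\<close> and losing height.\<close>
    define g' where "g' w = (if w \<in> B then g w else 0)" for w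
    have g'le: "g' w \<le> m" for w using le m0 by (auto simp: g'_def)
    have "(\<Sum>w\<in>B. r u w * g w) = (\<Sum>w\<in>V. r u w * g' w)"
      using V B by (intro sum.mono_neutral_cong_left) (auto simp: g'_def)
    with sub[OF u(1)] have "(\<Sum>w\<in>V. r u w * (m - g' w)) \<le> 0"
      by (simp add: u right_diff_distrib sum_subtractf mult.commute flip: sum_distrib_left sum_distrib_right)
    moreover have "r u w * (m - g' w) \<le> (\<Sum>w\<in>V. r u w * (m - g' w))"
      using V w u r g'le by (intro member_le_sum) auto
    ultimately have "r u w * (m - g' w) \<le> 0" by linarith
    then have "m \<le> g' w" using w by (simp add: mult_le_0_iff)
    with g'le[of w] m0 show ?case by (auto simp: g'_def split: if_splits)
  qed
  with y(1) show False by simp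
qed

section \<open>Elimination of states\<close>

lemma rtrancl_leave:
  assumes "(z, w) \<in> G\<^sup>*" "z \<noteq> w"
  shows "\<exists>u. u \<noteq> z \<and> (z, u) \<in> G"
  using assms
proof (induction rule: rtrancl_induct)
  case (step y w)
  then show ?case by metis
qed simp

lemma rtrancl_enter:
  assumes "(z, w) \<in> G\<^sup>*" "z \<noteq> w"
  shows "\<exists>u. u \<noteq> w \<and> (u, w) \<in> G"
  using assms
proof (induction rule: converse_rtrancl_induct)
  case (step y z)
  then show ?case by metis
qed simp

text \<open>The second conjunct carries the induction across a visit to \<open>z\<close>: it
  remembers the vertex \<open>u\<close> of \<open>W\<close> from which \<open>z\<close> was entered,
  so that leaving \<open>z\<close> later becomes a single edge of \<open>G'\<close> starting at
  \<open>u\<close>. Loops at \<open>z\<close> leave \<open>u\<close> unchanged.\<close>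

lemma rtrancl_bypass:
  assumes path: "(x, y) \<in> G\<^sup>*" and x: "x \<in> W" and G: "G \<subseteq> insert z W \<times> insert z W"
    and z: "z \<notin> W"
    and G': "G' = {(x, y) \<in> W \<times> W. (x, y) \<in> G \<or> (x, z) \<in> G \<and> (z, y) \<in> G}"
  shows "(y \<in> W \<longrightarrow> (x, y) \<in> G'\<^sup>*) \<and> (y = z \<longrightarrow> (\<exists>u\<in>W. (x, u) \<in> G'\<^sup>* \<and> (u, z) \<in> G))"
  using path
proof (induction rule: rtrancl_induct)
  case base
  then show ?case using x z by auto
next
  case (step y w)
  have yw: "y \<in> insert z W" "w \<in> insert z W" using G step.hyps(2) by auto
  show ?case
  proof (cases "y = z")
    case True
    then obtain u where u: "u \<in> W" "(x, u) \<in> G'\<^sup>*" "(u, z) \<in> G" using step.IH by auto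
    show ?thesis
    proof (cases "w = z")
      case True
      then show ?thesis using u z by auto
    next
      case False
      then have "(u, w) \<in> G'" using u yw step.hyps(2) True by (auto simp: G')
      then show ?thesis using u False by (auto intro: rtrancl_into_rtrancl)
    qed
  next
    case False
    then have y: "y \<in> W" "(x, y) \<in> G'\<^sup>*" using step.IH yw by auto
    have "(y, w) \<in> G'" if "w \<in> W" using y that step.hyps(2) by (auto simp: G')
    then show ?thesis using y step.hyps(2) z by (auto intro: rtrancl_into_rtrancl)
  qed
qed

text \<open>Only subtraction-free operations are demanded, and sums only within one degree. Values
  outside the index set \<open>I\<close> are irrelevant by \<open>K_cong\<close>.\<close>

locale positive_class =
  fixes K :: "int \<Rightarrow> ('i \<Rightarrow> real) \<Rightarrow> bool" and I :: "'i set"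
  assumes K_pos: "K d f \<Longrightarrow> i \<in> I \<Longrightarrow> 0 < f i"
    and K_cong: "K d f \<Longrightarrow> (\<And>i. i \<in> I \<Longrightarrow> f i = g i) \<Longrightarrow> K d g"
    and K_one: "K 0 (\<lambda>_. 1)"
    and K_add: "K d f \<Longrightarrow> K d g \<Longrightarrow> K d (\<lambda>i. f i + g i)"
    and K_mult: "K d f \<Longrightarrow> K e g \<Longrightarrow> K (d + e) (\<lambda>i. f i * g i)"
    and K_divide: "K d f \<Longrightarrow> K e g \<Longrightarrow> K (d - e) (\<lambda>i. f i / g i)"
begin

lemma K_sum:
  assumes "finite S" "S \<noteq> {}" "\<And>x. x \<in> S \<Longrightarrow> K d (\<lambda>i. f i x)"
  shows "K d (\<lambda>i. \<Sum>x\<in>S. f i x)"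
  using assms by (induction S rule: finite_ne_induct) (auto intro: K_add)

text \<open>Members of the class are positive on \<open>I\<close>, so a vanishing term cannot be
  treated as a summand from the class; \<open>S\<close> collects the remaining terms.\<close>

lemma K_sum_zero:
  assumes "finite T" "S \<subseteq> T" "S \<noteq> {}" "\<And>x. x \<in> S \<Longrightarrow> K d (\<lambda>i. f i x)"
    and z: "\<And>i x. i \<in> I \<Longrightarrow> x \<in> T - S \<Longrightarrow> f i x = 0"
  shows "K d (\<lambda>i. \<Sum>x\<in>T. f i x)"
proof (rule K_cong[OF K_sum])
  show "(\<Sum>x\<in>S. f i x) = (\<Sum>x\<in>T. f i x)" if "i \<in> I" for i
    using assms z[OF that] by (intro sum.mono_neutral_left) auto
qed (use assms(1-4) finite_subset[OF assms(2,1)] in auto)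

text \<open>Each induction step removes one state \<open>z\<close> and passes to the trace on
  \<open>W\<close>. The graph \<open>G\<close> is common to all \<open>i\<close>, so which terms
  vanish is known in advance and every sum to be classified runs over a nonempty set of members of
  the class.\<close>

theorem invariant_vec_class:
  assumes "finite V" "V \<noteq> {}" "G \<subseteq> V \<times> V"
    and "\<And>x y. (x, y) \<in> G \<Longrightarrow> K 1 (\<lambda>i. r i x y)"
    and "\<And>i x y. i \<in> I \<Longrightarrow> x \<in> V \<Longrightarrow> y \<in> V \<Longrightarrow> (x, y) \<notin> G \<Longrightarrow> r i x y = 0"
    and "\<And>x y. x \<in> V \<Longrightarrow> y \<in> V \<Longrightarrow> (x, y) \<in> G\<^sup>*"
  shows "\<exists>p. (\<forall>i\<in>I. invariant_vec V (r i) (p i)) \<and> (\<forall>i\<in>I. \<forall>x\<in>V. 0 < p i x) \<and>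
           (\<forall>x\<in>V. \<forall>y\<in>V. K 0 (\<lambda>i. p i x / p i y))"
  using assms
proof (induction V arbitrary: G r rule: finite_ne_induct)
  case (singleton v)
  show ?case
    by (rule exI[of _ "\<lambda>_ _. 1"]) (auto simp: invariant_vec_def K_one)
next
  case (insert z W)
  note G = insert.prems(1) and KG = insert.prems(2) and r0 = insert.prems(3) and irr = insert.prems(4)
  obtain w0 where w0: "w0 \<in> W" using insert by auto
  have zw0: "z \<noteq> w0" using w0 insert by auto
  define Out where "Out = {w\<in>W. (z, w) \<in> G}"
  define In where "In = {w\<in>W. (w, z) \<in> G}"
  have "Out \<noteq> {}" using rtrancl_leave[OF irr[of z w0] zw0] w0 G by (auto simp: Out_def)
  moreover have In: "In \<noteq> {}"
    using rtrancl_enter[OF irr[of w0 z]] zw0 w0 G by (auto simp: In_def)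
  \<comment> \<open>The loop rate at \<open>z\<close> is left out: from \<open>z\<close> the next
    vertex of \<open>W\<close> is \<open>w\<close> with probability \<open>r i z w / R i\<close>,
    and no geometric series or subtraction enters.\<close>
  define R where "R i = (\<Sum>w\<in>W. r i z w)" for i
  ultimately have KR: "K 1 R" unfolding R_def
    by (intro K_sum_zero[where S = Out]) (use insert KG r0 in \<open>auto simp: Out_def\<close>)
  have R: "R i > 0" if "i \<in> I" for i using K_pos[OF KR that] .
  define G' where "G' = {(x, y) \<in> W \<times> W. (x, y) \<in> G \<or> (x, z) \<in> G \<and> (z, y) \<in> G}"
  \<comment> \<open>The added term is the rate of excursions from \<open>x\<close> through
    \<open>z\<close> that end at \<open>y\<close>. It may create diagonal rates, which contribute
    equally to both sides of the balance equation.\<close>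
  define r' where "r' i x y = r i x y + r i x z * r i z y / R i" for i x y
  have "\<exists>p. (\<forall>i\<in>I. invariant_vec W (r' i) (p i)) \<and> (\<forall>i\<in>I. \<forall>x\<in>W. 0 < p i x) \<and>
           (\<forall>x\<in>W. \<forall>y\<in>W. K 0 (\<lambda>i. p i x / p i y))"
  proof (rule insert.IH)
    show "G' \<subseteq> W \<times> W" by (auto simp: G'_def)
    show "K 1 (\<lambda>i. r' i x y)" if "(x, y) \<in> G'" for x y
    proof -
      have xy: "x \<in> W" "y \<in> W" using that by (auto simp: G'_def)
      have *: "K 1 (\<lambda>i. r i x z * r i z y / R i)" if "(x, z) \<in> G" "(z, y) \<in> G"
        using K_divide[OF K_mult[OF KG[OF that(1)] KG[OF that(2)]] KR] by simp
      consider "(x, y) \<in> G" "(x, z) \<in> G" "(z, y) \<in> G" | "(x, y) \<in> G" "(x, z) \<notin> G \<or> (z, y) \<notin> G"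
        | "(x, y) \<notin> G" "(x, z) \<in> G" "(z, y) \<in> G" using \<open>(x, y) \<in> G'\<close> by (auto simp: G'_def)
      then show ?thesis
      proof cases
        case 1
        then show ?thesis unfolding r'_def using K_add[OF KG *] by simp
      next
        case 2
        then show ?thesis
          by (intro K_cong[OF KG[OF 2(1)]]) (use xy r0 in \<open>auto simp: r'_def\<close>)
      next
        case 3
        then show ?thesis
          by (intro K_cong[OF *[OF 3(2,3)]]) (use xy r0 in \<open>auto simp: r'_def\<close>)
      qed
    qed
    show "r' i x y = 0" if "i \<in> I" "x \<in> W" "y \<in> W" "(x, y) \<notin> G'" for i x y
      using that r0[of i x y] r0[of i x z] r0[of i z y] by (auto simp: r'_def G'_def)
    show "(x, y) \<in> G'\<^sup>*" if "x \<in> W" "y \<in> W" for x y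
      using rtrancl_bypass[OF irr[of x y] that(1) G insert.hyps(3) G'_def] that by auto
  qed
  then obtain p where pinv: "\<And>i. i \<in> I \<Longrightarrow> invariant_vec W (r' i) (p i)"
    and ppos: "\<And>i x. i \<in> I \<Longrightarrow> x \<in> W \<Longrightarrow> 0 < p i x"
    and pK: "\<And>x y. x \<in> W \<Longrightarrow> y \<in> W \<Longrightarrow> K 0 (\<lambda>i. p i x / p i y)" by metis
  \<comment> \<open>This value is forced by balance at \<open>z\<close>, where the loop terms
    cancel.\<close>
  define pz where "pz i = (\<Sum>x\<in>W. p i x * r i x z) / R i" for i
  define q where "q i = (p i)(z := pz i)" for i
  have qz: "q i z = pz i" for i by (simp add: q_def)
  have qW: "q i x = p i x" if "x \<in> W" for i x using that insert.hyps by (auto simp: q_def)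
  \<comment> \<open>The division by \<open>p i y\<close> is carried out inside the sum because only
    ratios of the weights are known to lie in the class.\<close>
  have Kz: "K 0 (\<lambda>i. pz i / p i y)" if y: "y \<in> W" for y
  proof -
    have "K 1 (\<lambda>i. \<Sum>x\<in>W. p i x / p i y * r i x z)"
    proof (rule K_sum_zero[where S = In])
      show "K 1 (\<lambda>i. p i x / p i y * r i x z)" if "x \<in> In" for x
        using K_mult[OF pK[OF _ y] KG, of x x z] that by (auto simp: In_def)
    qed (use insert In r0 in \<open>auto simp: In_def\<close>)
    from K_divide[OF this KR] have "K 0 (\<lambda>i. (\<Sum>x\<in>W. p i x / p i y * r i x z) / R i)" by simp
    then show ?thesis
      by (rule K_cong) (simp add: pz_def sum_divide_distrib ac_simps)
  qed
  have pzpos: "pz i > 0" if "i \<in> I" for i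
    using K_pos[OF Kz[OF w0] that] ppos[OF that w0] by (simp add: zero_less_divide_iff)
  have inv: "invariant_vec (insert z W) (r i) (q i)" if i: "i \<in> I" for i
    unfolding invariant_vec_def
  proof
    fix x assume x: "x \<in> insert z W"
    have sW: "(\<Sum>y\<in>W. q i y * r i y x) = (\<Sum>y\<in>W. p i y * r i y x)" for x
      by (rule sum.cong) (auto simp: qW)
    have pzR: "pz i * R i = (\<Sum>x\<in>W. p i x * r i x z)" using R[OF i] by (simp add: pz_def)
    show "q i x * (\<Sum>y\<in>insert z W. r i x y) = (\<Sum>y\<in>insert z W. q i y * r i y x)"
    proof (cases "x = z")
      case True
      have "q i x * (\<Sum>y\<in>insert z W. r i x y) = pz i * r i z z + pz i * R i"
        using insert.hyps by (simp add: True qz R_def distrib_left)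
      then show ?thesis unfolding pzR using insert.hyps by (simp add: True qz sW)
    next
      case False
      then have x: "x \<in> W" using x by simp
      have out: "(\<Sum>y\<in>W. r' i x y) = (\<Sum>y\<in>W. r i x y) + r i x z"
      proof -
        have "(\<Sum>y\<in>W. r' i x y) = (\<Sum>y\<in>W. r i x y) + r i x z * R i / R i"
          unfolding r'_def R_def by (simp add: sum.distrib sum_divide_distrib sum_distrib_left)
        then show ?thesis using R[OF i] by simp
      qed
      have "(\<Sum>y\<in>W. p i y * r' i y x) = (\<Sum>y\<in>W. p i y * r i y x) + pz i * r i z x"
        unfolding r'_def pz_def sum_divide_distrib sum_distrib_right
        by (simp add: distrib_left sum.distrib mult.assoc)
      then have "p i x * ((\<Sum>y\<in>W. r i x y) + r i x z) = (\<Sum>y\<in>W. p i y * r i y x) + pz i * r i z x"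
        using pinv[OF i] x unfolding invariant_vec_def out[symmetric] by simp
      then show ?thesis using insert.hyps x by (simp add: qW qz sW ac_simps)
    qed
  qed
  have pos: "0 < q i x" if "i \<in> I" "x \<in> insert z W" for i x
    using that ppos pzpos by (auto simp: q_def)
  have "K 0 (\<lambda>i. q i x / q i y)" if xy: "x \<in> insert z W" "y \<in> insert z W" for x y
  proof -
    consider "x \<in> W" "y \<in> W" | "x = z" "y \<in> W" | "x \<in> W" "y = z" | "x = z" "y = z"
      using xy by auto
    then show ?thesis
    proof cases
      case 1 then show ?thesis by (simp add: qW pK)
    next
      case 2 then show ?thesis by (simp add: qW qz Kz)
    next
      case 3
      have "K 0 (\<lambda>i. 1 / (pz i / p i x))" using K_divide[OF K_one Kz[OF 3(1)]] by simp
      then show ?thesis using 3 by (simp add: qW qz)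
    next
      case 4
      then show ?thesis by (intro K_cong[OF K_one]) (use pzpos in \<open>force simp: qz\<close>)
    qed
  qed
  then show ?case using inv pos by blast
qed

text \<open>A share is the reciprocal of a sum of ratios of weights, hence of degree
  \<open>0\<close> and independent of the normalisation. Letting \<open>S\<close> be a proper subset
  of \<open>V\<close> covers conditional laws as well.\<close>

lemma
  assumes V: "finite V" "V \<noteq> {}" and G: "G \<subseteq> V \<times> V"
    and KG: "\<And>x y. (x, y) \<in> G \<Longrightarrow> K 1 (\<lambda>i. r i x y)"
    and r0: "\<And>i x y. i \<in> I \<Longrightarrow> x \<in> V \<Longrightarrow> y \<in> V \<Longrightarrow> (x, y) \<notin> G \<Longrightarrow> r i x y = 0"
    and irr: "\<And>x y. x \<in> V \<Longrightarrow> y \<in> V \<Longrightarrow> (x, y) \<in> G\<^sup>*"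
  defines "P \<equiv> \<lambda>i. pmf (inv_measure V (r i))"
  shows inv_measure_invariant: "i \<in> I \<Longrightarrow> invariant_vec V (r i) (P i)"
    and inv_measure_pos: "i \<in> I \<Longrightarrow> x \<in> V \<Longrightarrow> 0 < P i x"
    and inv_measure_outside: "i \<in> I \<Longrightarrow> x \<notin> V \<Longrightarrow> P i x = 0"
    and inv_measure_sum: "i \<in> I \<Longrightarrow> sum (P i) V = 1"
    and inv_measure_share:
      "x \<in> V \<Longrightarrow> S \<subseteq> V \<Longrightarrow> S \<noteq> {} \<Longrightarrow> K 0 (\<lambda>i. P i x / sum (P i) S)"
proof -
  obtain p where inv: "\<forall>i\<in>I. invariant_vec V (r i) (p i)" and pos: "\<forall>i\<in>I. \<forall>x\<in>V. 0 < p i x"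
    and pK: "\<forall>x\<in>V. \<forall>y\<in>V. K 0 (\<lambda>i. p i x / p i y)"
    using invariant_vec_class[where r = r, OF V G KG r0 irr] by blast
  have rpos: "0 < r i x y" if "i \<in> I" "(x, y) \<in> G" for i x y
    using K_pos[OF KG[OF that(2)] that(1)] .
  then have nonneg: "0 \<le> r i x y" if "i \<in> I" "x \<in> V" "y \<in> V" for i x y
    using r0[OF that] that(1) by (cases "(x, y) \<in> G") (auto intro: less_imp_le)
  have "support_graph V (r i) = G" if "i \<in> I" for i
    using rpos[OF that] r0[OF that] G by (fastforce simp: support_graph_def)
  then have path: "(x, y) \<in> (support_graph V (r i))\<^sup>*" if "i \<in> I" "x \<in> V" "y \<in> V" for i x y
    using irr that by simp
  have P: "P i x = (if x \<in> V then p i x / sum (p i) V else 0)" if "i \<in> I" for i x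
    unfolding P_def using that pos inv by (intro pmf_inv_measure[OF V nonneg path]) auto
  have s: "0 < sum (p i) V" if "i \<in> I" for i
    using V pos that by (intro sum_pos) auto
  show "0 < P i x" if "i \<in> I" "x \<in> V" for x i
    using P[OF that(1), of x] s[OF that(1)] that pos by simp
  show "P i x = 0" if "i \<in> I" "x \<notin> V" for x i
    using P[OF that(1), of x] that by simp
  have sumP: "sum (P i) S = sum (p i) S / sum (p i) V" if "i \<in> I" "S \<subseteq> V" for i S
    unfolding sum_divide_distrib by (rule sum.cong) (use P[OF that(1)] that(2) in auto)
  show "sum (P i) V = 1" if "i \<in> I" for i
    using sumP[OF that, of V] s[OF that] by simp
  show "invariant_vec V (r i) (P i)" if "i \<in> I" for i
    unfolding invariant_vec_def
  proof
    fix x assume x: "x \<in> V"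
    have "(\<Sum>y\<in>V. P i y * r i y x) = (\<Sum>y\<in>V. p i y * r i y x) / sum (p i) V"
      unfolding sum_divide_distrib by (rule sum.cong) (use P[OF that] in auto)
    then show "P i x * (\<Sum>y\<in>V. r i x y) = (\<Sum>y\<in>V. P i y * r i y x)"
      using inv that x P[OF that, of x] by (simp add: invariant_vec_def)
  qed
  show "K 0 (\<lambda>i. P i x / sum (P i) S)" if x: "x \<in> V" and S: "S \<subseteq> V" "S \<noteq> {}" for x S
  proof -
    have "K 0 (\<lambda>i. \<Sum>y\<in>S. p i y / p i x)"
      using S x pK finite_subset[OF S(1) V(1)] by (intro K_sum) auto
    from K_divide[OF K_one this] have "K 0 (\<lambda>i. 1 / (\<Sum>y\<in>S. p i y / p i x))" by simp
    then show ?thesis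
    proof (rule K_cong)
      fix i assume i: "i \<in> I"
      show "1 / (\<Sum>y\<in>S. p i y / p i x) = P i x / sum (P i) S"
        unfolding sumP[OF i S(1)] P[OF i, of x] using x s[OF i] by (simp flip: sum_divide_distrib)
    qed
  qed
qed

end

section \<open>Entrance probabilities\<close>

text \<open>Recursion on the first step makes these events measurable for each \<open>n\<close> and
  leads directly to one-step analysis. Requiring the next state to lie in \<open>V\<close> keeps the
  case distinction finite.\<close>

primrec enters :: "'v set \<Rightarrow> 'v set \<Rightarrow> 'v \<Rightarrow> nat \<Rightarrow> 'v \<Rightarrow> (('v \<Rightarrow> 'v) \<times> real) stream \<Rightarrow> bool" where
  "enters V A y 0 z \<omega> \<longleftrightarrow> z = y"
| "enters V A y (Suc n) z \<omega> \<longleftrightarrow>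
     z \<notin> A \<and> fst (shd \<omega>) z \<in> V \<and> enters V A y n (fst (shd \<omega>) z) (stl \<omega>)"

definition regular_step :: "'v set \<Rightarrow> ('v \<Rightarrow> 'v) \<times> real \<Rightarrow> bool" where
  "regular_step V s \<longleftrightarrow> 0 < snd s \<and> (\<forall>x\<in>V. fst s x \<in> V)"

lemma jump_chain_Suc: "jump_chain z \<omega> (Suc n) = jump_chain (fst (shd \<omega>) z) (stl \<omega>) n"
  by (induction n) auto

lemma jump_chain_in:
  assumes "stream_all (regular_step V) \<omega>" "z \<in> V"
  shows "jump_chain z \<omega> n \<in> V"
  using assms by (induction n) (auto simp: stream_all_def regular_step_def)

lemma enters_iff:
  assumes "stream_all (regular_step V) \<omega>" "z \<in> V"
  shows "enters V A y n z \<omega> \<longleftrightarrow> jump_chain z \<omega> n = y \<and> (\<forall>k<n. jump_chain z \<omega> k \<notin> A)"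
  using assms
proof (induction n arbitrary: z \<omega>)
  case (Suc n)
  have "regular_step V (shd \<omega>)" and st: "stream_all (regular_step V) (stl \<omega>)"
    using Suc.prems unfolding stream_all_def by (metis snth.simps(1), metis snth.simps(2))
  then have w: "fst (shd \<omega>) z \<in> V" using Suc.prems by (auto simp: regular_step_def)
  show ?case
    unfolding enters.simps jump_chain_Suc All_less_Suc2 Suc.IH[OF st w] using w by auto
qed auto

locale jump_rates =
  fixes V :: "'v set" and r :: "'v \<Rightarrow> 'v \<Rightarrow> real"
  assumes finV: "finite V"
    and rate_nonneg: "\<And>x y. x \<in> V \<Longrightarrow> y \<in> V \<Longrightarrow> 0 \<le> r x y"
    and exit_pos: "\<And>x. x \<in> V \<Longrightarrow> 0 < exit_rate V r x"
begin

text \<open>Explosion need not be excluded: past all jump times \<open>chain\<close> has a junk value, but it is still a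
  value of the jump chain, so if it lies in \<open>A\<close> then \<open>A\<close> was already entered at a jump time.\<close>

lemma chain_enters_iff:
  assumes reg: "stream_all (regular_step V) \<omega>" and z: "z \<in> V" and y: "y \<in> A"
  shows "(\<exists>t\<ge>0. chain V r z \<omega> t \<in> A \<and> chain V r z \<omega> t = y \<and>
            (\<forall>s. 0 \<le> s \<and> s < t \<longrightarrow> chain V r z \<omega> s \<notin> A))
         \<longleftrightarrow> (\<exists>n. enters V A y n z \<omega>)" (is "?L \<longleftrightarrow> ?R")
proof -
  let ?X = "jump_chain z \<omega>" and ?T = "jump_time V r z \<omega>" and ?C = "chain V r z \<omega>"
  have step: "?T n < ?T (Suc n)" for n
    using reg jump_chain_in[OF reg z, of n] exit_pos
    by (simp add: jump_time_def stream_all_def regular_step_def)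
  have mono: "?T m \<le> ?T n" if "m \<le> n" for m n
    by (rule lift_Suc_mono_le[where f = ?T, OF less_imp_le[OF step] that])
  \<comment> \<open>The strict inequality in the definition of \<open>chain\<close> makes paths
    right-continuous, so at the \<open>n\<close>-th jump time the new position is already
    taken.\<close>
  have at_jump: "?C (?T n) = ?X n" for n
  proof -
    have "n \<le> k" if "?T n < ?T (Suc k)" for k
      using that mono[of "Suc k" n] by (meson leD not_less_eq_eq)
    then have "(LEAST k. ?T n < ?T (Suc k)) = n" by (intro Least_equality step)
    then show ?thesis by (simp only: chain_def)
  qed
  have before: "\<exists>k<n. ?C s = ?X k" if s: "0 \<le> s" "s < ?T n" for s n
  proof -
    obtain m where m: "n = Suc m" using s by (cases n) (simp_all add: jump_time_def)
    have "(LEAST k. s < ?T (Suc k)) \<le> m" by (rule Least_le) (use s m in simp)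
    then show ?thesis unfolding chain_def using m le_imp_less_Suc by blast
  qed
  have T0: "0 \<le> ?T n" for n using mono[of 0 n] by (simp add: jump_time_def)
  show ?thesis
  proof
    assume ?R
    then obtain n where n: "?X n = y" "\<And>k. k < n \<Longrightarrow> ?X k \<notin> A"
      using enters_iff[OF reg z] by auto
    then show ?L using y T0 before[of _ n] at_jump by (intro exI[of _ "?T n"]) metis
  next
    assume ?L
    then obtain t where t: "0 \<le> t" "?C t = y" "\<And>s. 0 \<le> s \<Longrightarrow> s < t \<Longrightarrow> ?C s \<notin> A" by auto
    have "\<exists>k. ?X k \<in> A" using t(2) y unfolding chain_def by auto
    define n where "n = (LEAST k. ?X k \<in> A)"
    have n: "?X n \<in> A" "\<And>k. k < n \<Longrightarrow> ?X k \<notin> A"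
      unfolding n_def using \<open>\<exists>k. ?X k \<in> A\<close> by (auto intro: LeastI_ex dest: not_less_Least)
    \<comment> \<open>Both bounds together pin \<open>t\<close> to the jump time at which the jump
      chain first visits \<open>A\<close>.\<close>
    have "\<not> ?T n < t" using t(3)[OF T0, of n] at_jump n by auto
    moreover have "\<not> t < ?T n" using before[OF t(1), of n] t(2) y n(2) by auto
    ultimately have "?X n = y" using t(2) at_jump[of n] by force
    then show ?R using n enters_iff[OF reg z] by auto
  qed
qed

section \<open>Measurability and one-step analysis of the entrance events\<close>

lemma pmf_jump:
  assumes "z \<in> V"
  shows "pmf (jump_pmf V r z) w = (if w \<in> V then r z w / exit_rate V r z else 0)"
  unfolding jump_pmf_def
proof (rule pmf_embed_finite[OF finV])
  show "0 \<le> (if w \<in> V then r z w / exit_rate V r z else 0)" for w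
    using assms exit_pos[OF assms] rate_nonneg by simp
  show "(\<Sum>w\<in>V. if w \<in> V then r z w / exit_rate V r z else 0) = 1"
    using exit_pos[OF assms] by (simp add: exit_rate_def flip: sum_divide_distrib)
qed simp

lemma prob_space_step: "prob_space (step_space V r)"
  unfolding step_space_def
  by (intro prob_space_pair prob_space_measure_pmf prob_space_exponential_density) simp

lemma measurable_target [measurable]:
  "(\<lambda>s. fst s z) \<in> measurable (step_space V r) (count_space UNIV)"
  unfolding step_space_def by (rule measurable_compose[OF measurable_fst]) simp

lemma measurable_holding [measurable]: "snd \<in> borel_measurable (step_space V r)"
  unfolding step_space_def by measurable

lemma measurable_enters [measurable]:
  "Measurable.pred (stream_space (step_space V r)) (enters V A y n z)"
proof (induction n arbitrary: z)
  case (Suc n)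
  note Suc[measurable]
  have "enters V A y (Suc n) z =
      (\<lambda>\<omega>. z \<notin> A \<and> (\<exists>w\<in>V. fst (shd \<omega>) z = w \<and> enters V A y n w (stl \<omega>)))"
    by (auto simp: fun_eq_iff)
  also have "Measurable.pred (stream_space (step_space V r)) \<dots>"
    using finV by measurable
  finally show ?case .
next
  case 0
  have "enters V A y 0 z = (\<lambda>_. z = y)" by (simp add: fun_eq_iff)
  then show ?case by simp
qed

lemma AE_regular: "AE \<omega> in stream_space (step_space V r). stream_all (regular_step V) \<omega>"
proof (rule prob_space.AE_stream_all[OF prob_space_step])
  let ?P = "Pi_pmf V undefined (jump_pmf V r)" and ?E = "density lborel (exponential_density 1)"
  have eq: "regular_step V s \<longleftrightarrow> 0 < snd s \<and> (\<forall>x\<in>V. \<exists>w\<in>V. fst s x = w)" for s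
    by (auto simp: regular_step_def)
  show m: "Measurable.pred (step_space V r) (regular_step V)"
    unfolding eq[abs_def] using finV by measurable
  interpret P: prob_space ?P by (rule prob_space_measure_pmf)
  interpret E: prob_space ?E by (rule prob_space_exponential_density) simp
  interpret pair_sigma_finite ?P ?E ..
  have "AE f in ?P. \<forall>x\<in>V. f x \<in> V"
  proof (rule AE_pmfI)
    fix f assume "f \<in> set_pmf ?P"
    then have "f x \<in> set_pmf (jump_pmf V r x)" if "x \<in> V" for x
      using that finV by (auto simp: set_Pi_pmf PiE_dflt_def)
    then have "f x \<in> V" if "x \<in> V" for x
      using that pmf_jump[OF that, of "f x"] by (auto simp: set_pmf_iff split: if_splits)
    then show "\<forall>x\<in>V. f x \<in> V" by blast
  qed
  moreover have "AE t in ?E. 0 < t"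
    using AE_lborel_singleton[of 0]
    by (subst AE_density) (auto elim!: eventually_mono simp: exponential_density_def)
  ultimately have "AE f in ?P. AE t in ?E. regular_step V (f, t)"
    by (auto simp: regular_step_def elim!: eventually_mono)
  moreover have "{s \<in> space (?P \<Otimes>\<^sub>M ?E). regular_step V s} \<in> sets (?P \<Otimes>\<^sub>M ?E)"
    using m unfolding step_space_def by measurable
  ultimately show "AE s in step_space V r. regular_step V s"
    unfolding step_space_def by (intro AE_pair_measure) auto
qed

definition entrance :: "'v set \<Rightarrow> 'v \<Rightarrow> 'v \<Rightarrow> real" where
  "entrance A z y = \<P>(\<omega> in stream_space (step_space V r). \<exists>n. enters V A y n z \<omega>)"

text \<open>The event in \<open>entrance_prob\<close> quantifies over uncountably many times and is
  not visibly measurable. Outside the null set of irregular paths it coincides with a countable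
  union of measurable events, which makes it measurable for the completion and gives both the same
  probability.\<close>

lemma entrance_prob_eq:
  assumes z: "z \<in> V" and y: "y \<in> A"
  shows "entrance_prob V r A z y = entrance A z y"
proof -
  let ?S = "stream_space (step_space V r)"
  let ?L = "\<lambda>\<omega>. \<exists>t\<ge>0. chain V r z \<omega> t \<in> A \<and> chain V r z \<omega> t = y \<and>
            (\<forall>s. 0 \<le> s \<and> s < t \<longrightarrow> chain V r z \<omega> s \<notin> A)"
  let ?R = "\<lambda>\<omega>. \<exists>n. enters V A y n z \<omega>"
  have ae: "AE \<omega> in completion ?S. ?L \<omega> \<longleftrightarrow> ?R \<omega>"
    using AE_completion[OF AE_regular] chain_enters_iff[OF _ z y] by (auto elim!: eventually_mono)
  have R: "Measurable.pred (completion ?S) ?R"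
    by (intro measurable_completion) measurable
  have "AE \<omega> in ?S. \<not> (\<not> (?L \<omega> \<longleftrightarrow> ?R \<omega>))" using ae by (simp add: AE_completion_iff)
  then have "Measurable.pred (completion ?S) (\<lambda>\<omega>. \<not> (?L \<omega> \<longleftrightarrow> ?R \<omega>))"
    by (rule sets_completion_AE)
  from pred_intros_logic(2)[OF this] have "Measurable.pred (completion ?S) (\<lambda>\<omega>. ?L \<omega> \<longleftrightarrow> ?R \<omega>)"
    by simp
  \<comment> \<open>\<open>?L\<close> is recovered from \<open>?R\<close> and the measurable set on
    which the two agree.\<close>
  then have "Measurable.pred (completion ?S) (\<lambda>\<omega>. (?L \<omega> \<longleftrightarrow> ?R \<omega>) \<longleftrightarrow> ?R \<omega>)"
    using R by (rule pred_intros_logic)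
  then have L: "Measurable.pred (completion ?S) ?L"
    by (rule measurable_cong[THEN iffD1, rotated]) blast
  have "entrance_prob V r A z y = \<P>(\<omega> in completion ?S. ?R \<omega>)"
    unfolding entrance_prob_def path_space_def
    by (rule measure_eq_AE[OF _ predE[OF L] predE[OF R]]) (use ae in \<open>auto elim!: eventually_mono\<close>)
  also have "\<dots> = entrance A z y" unfolding entrance_def space_completion
    by (rule measure_completion) measurable
  finally show ?thesis .
qed

lemma entrance_nonneg: "0 \<le> entrance A z y"
  by (simp add: entrance_def)

lemma entrance_inside:
  assumes "z \<in> A"
  shows "entrance A z y = (if z = y then 1 else 0)"
proof -
  interpret prob_space "stream_space (step_space V r)"
    by (rule prob_space.prob_space_stream_space[OF prob_space_step])
  have "enters V A y n z \<omega> \<longleftrightarrow> n = 0 \<and> z = y" for n \<omega> using assms by (cases n) auto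
  then show ?thesis by (simp add: entrance_def prob_space)
qed

text \<open>The stream is a first step followed by an independent stream of the same law. The
  holding time integrates out, and the jump target from \<open>z\<close> is a marginal of the
  product law of targets.\<close>

lemma entrance_step:
  assumes z: "z \<in> V" "z \<notin> A" and y: "y \<in> A"
  shows "exit_rate V r z * entrance A z y = (\<Sum>w\<in>V. r z w * entrance A w y)"
proof -
  let ?S = "stream_space (step_space V r)"
  let ?P = "Pi_pmf V undefined (jump_pmf V r)" and ?E = "density lborel (exponential_density 1)"
  interpret S: prob_space "step_space V r" by (rule prob_space_step)
  interpret E: prob_space ?E by (rule prob_space_exponential_density) simp
  define g where "g w = (if w \<in> V then ennreal (entrance A w y) else 0)" for w
  have gm: "(\<lambda>t. g (fst t z)) \<in> borel_measurable (step_space V r)"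
    by (rule measurable_compose[OF measurable_target]) simp
  \<comment> \<open>Index \<open>0\<close> cannot occur since \<open>y\<close> lies in
    \<open>A\<close> and \<open>z\<close> does not, so every entrance uses the first step.\<close>
  have enters: "(\<exists>n. enters V A y n z (t ## \<omega>)) \<longleftrightarrow>
      fst t z \<in> V \<and> (\<exists>n. enters V A y n (fst t z) \<omega>)" for t \<omega>
  proof -
    have "(\<exists>n. enters V A y n z (t ## \<omega>)) \<longleftrightarrow> (\<exists>n. enters V A y (Suc n) z (t ## \<omega>))"
      using z y by (metis enters.simps(1) not0_implies_Suc)
    then show ?thesis using z by simp
  qed
  have "ennreal (entrance A z y) =
      (\<integral>\<^sup>+t. \<P>(\<omega> in ?S. \<exists>n. enters V A y n z (t ## \<omega>)) \<partial>step_space V r)"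
    unfolding entrance_def by (rule S.prob_stream_space) measurable
  also have "\<dots> = (\<integral>\<^sup>+t. g (fst t z) \<partial>step_space V r)"
    by (rule nn_integral_cong) (auto simp: enters g_def entrance_def)
  also have "\<dots> = (\<integral>\<^sup>+f. \<integral>\<^sup>+\<tau>. g (f z) \<partial>?E \<partial>?P)"
    using E.nn_integral_fst[OF gm[unfolded step_space_def]] by (simp add: step_space_def)
  also have "\<dots> = (\<integral>\<^sup>+f. g (f z) \<partial>?P)"
    by (rule nn_integral_cong) (simp only: nn_integral_const E.emeasure_space_1 mult_1_right)
  also have "\<dots> = (\<integral>\<^sup>+w. g w \<partial>map_pmf (\<lambda>f. f z) ?P)" by simp
  also have "\<dots> = (\<integral>\<^sup>+w. g w \<partial>jump_pmf V r z)"
    using finV z by (subst Pi_pmf_component) auto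
  also have "\<dots> = (\<integral>\<^sup>+w. ennreal (pmf (jump_pmf V r z) w) * g w \<partial>count_space UNIV)"
    by (rule nn_integral_measure_pmf)
  also have "\<dots> = (\<integral>\<^sup>+w. ennreal (pmf (jump_pmf V r z) w) * g w \<partial>count_space V)"
    by (rule nn_integral_count_space_eq) (auto simp: g_def)
  also have "\<dots> = (\<Sum>w\<in>V. ennreal (pmf (jump_pmf V r z) w * entrance A w y))"
    using finV by (simp add: nn_integral_count_space_finite g_def ennreal_mult' cong: sum.cong)
  also have "\<dots> = ennreal (\<Sum>w\<in>V. pmf (jump_pmf V r z) w * entrance A w y)"
    by (rule sum_ennreal) (simp add: entrance_nonneg)
  finally have "entrance A z y = (\<Sum>w\<in>V. pmf (jump_pmf V r z) w * entrance A w y)"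
    by (subst (asm) ennreal_inj) (auto intro!: sum_nonneg simp: entrance_nonneg)
  then have "entrance A z y = (\<Sum>w\<in>V. r z w * entrance A w y) / exit_rate V r z"
    using z by (simp add: pmf_jump sum_divide_distrib cong: sum.cong)
  then show ?thesis using exit_pos[OF z(1)] by (simp add: field_simps)
qed

end

section \<open>Families of rates with comparable monomials\<close>

definition edge_monomial ::
  "('v \<times> 'v) set \<Rightarrow> (nat \<Rightarrow> 'v \<Rightarrow> 'v \<Rightarrow> real) \<Rightarrow> ('v \<times> 'v \<Rightarrow> nat) \<Rightarrow> nat \<Rightarrow> real" where
  "edge_monomial E r m N = (\<Prod>(x, y)\<in>E. r N x y ^ m (x, y))"

lemma edge_monomial_add:
  "edge_monomial E r (\<lambda>e. m e + n e) N = edge_monomial E r m N * edge_monomial E r n N"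
  unfolding edge_monomial_def by (simp add: power_add case_prod_unfold prod.distrib)

text \<open>\<open>m\<close> and \<open>n\<close> encode the Laurent monomial with exponents
  \<open>m - n\<close>. They are kept as two natural families because \<open>assumption_A\<close>
  speaks of natural exponents; \<open>d\<close> is the total degree.\<close>

definition monomial_like ::
  "('v \<times> 'v) set \<Rightarrow> (nat \<Rightarrow> 'v \<Rightarrow> 'v \<Rightarrow> real) \<Rightarrow> int \<Rightarrow> (nat \<Rightarrow> real) \<Rightarrow> bool" where
  "monomial_like E r d f \<longleftrightarrow> (\<forall>N>0. 0 < f N) \<and>
     (\<exists>m n L. int (\<Sum>e\<in>E. m e) - int (\<Sum>e\<in>E. n e) = d \<and> 0 < L \<and>
        (\<lambda>N. f N * edge_monomial E r n N / edge_monomial E r m N) \<longlonglongrightarrow> L)"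

lemma LIMSEQ_cong_pos:
  fixes f :: "nat \<Rightarrow> real"
  assumes "f \<longlonglongrightarrow> L" "\<And>N. N > 0 \<Longrightarrow> f N = g N"
  shows "g \<longlonglongrightarrow> L"
  using assms(1)
  by (rule Lim_transform_eventually) (use assms(2) in \<open>auto intro: eventually_sequentiallyI[of 1]\<close>)

locale comparable_rates =
  fixes E :: "('v \<times> 'v) set" and r :: "nat \<Rightarrow> 'v \<Rightarrow> 'v \<Rightarrow> real"
  assumes finE: "finite E"
    and rate_pos: "\<And>N x y. N > 0 \<Longrightarrow> (x, y) \<in> E \<Longrightarrow> r N x y > 0"
    and A: "assumption_A E r"
begin

abbreviation mon :: "('v \<times> 'v \<Rightarrow> nat) \<Rightarrow> nat \<Rightarrow> real" where
  "mon \<equiv> edge_monomial E r"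

lemma mon_pos: "N > 0 \<Longrightarrow> 0 < mon m N"
  unfolding edge_monomial_def by (rule prod_pos) (use rate_pos in auto)

text \<open>If the limit in \<open>[0, \<infinity>]\<close> is infinite, the reciprocal ratio tends
  to \<open>0\<close>; hence two monomials of equal degree are always comparable.\<close>

lemma mon_ratio_cases:
  assumes "(\<Sum>e\<in>E. m e) = (\<Sum>e\<in>E. n e)"
  shows "convergent (\<lambda>N. mon m N / mon n N) \<or> convergent (\<lambda>N. mon n N / mon m N)"
proof -
  obtain L where L: "(\<lambda>N. ennreal (mon m N / mon n N)) \<longlonglongrightarrow> L"
    using A assms unfolding assumption_A_def edge_monomial_def by blast
  show ?thesis
  proof (cases L)
    case (real l)
    have "\<forall>\<^sub>F N in sequentially. 0 \<le> mon m N / mon n N"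
      using mon_pos by (intro eventually_sequentiallyI[of 1]) (auto intro!: divide_nonneg_nonneg less_imp_le)
    then have "(\<lambda>N. mon m N / mon n N) \<longlonglongrightarrow> l"
      using L real by (intro iffD1[OF tendsto_ennreal_iff]) auto
    then show ?thesis by (auto simp: convergent_def)
  next
    case top
    have "filterlim (\<lambda>N. mon m N / mon n N) at_top sequentially"
      using L top by (simp add: ennreal_tendsto_top_eq_at_top)
    then have "(\<lambda>N. inverse (mon m N / mon n N)) \<longlonglongrightarrow> 0" by (rule tendsto_inverse_0_at_top)
    then show ?thesis by (auto simp: convergent_def)
  qed
qed

lemma monomial_likeI:
  assumes "\<forall>N>0. 0 < f N" "int (\<Sum>e\<in>E. m e) - int (\<Sum>e\<in>E. n e) = d" "0 < L"
    "(\<lambda>N. f N * mon n N / mon m N) \<longlonglongrightarrow> L"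
  shows "monomial_like E r d f"
  using assms unfolding monomial_like_def by blast

lemma monomial_likeE:
  assumes "monomial_like E r d f"
  obtains m n L where "\<forall>N>0. 0 < f N" "int (\<Sum>e\<in>E. m e) - int (\<Sum>e\<in>E. n e) = d" "0 < L"
    "(\<lambda>N. f N * mon n N / mon m N) \<longlonglongrightarrow> L"
  using assms unfolding monomial_like_def by blast

text \<open>Here the monomial of \<open>g\<close> dominates, so the sum is asymptotic to a multiple
  of it. The constant \<open>L1 * l + L2\<close> is positive because nothing can cancel.\<close>

lemma monomial_like_add_aux:
  assumes f: "\<forall>N>0. 0 < f N" "int (\<Sum>e\<in>E. m1 e) - int (\<Sum>e\<in>E. n1 e) = d" "0 < L1"
    "(\<lambda>N. f N * mon n1 N / mon m1 N) \<longlonglongrightarrow> L1"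
    and g: "\<forall>N>0. 0 < g N" "int (\<Sum>e\<in>E. m2 e) - int (\<Sum>e\<in>E. n2 e) = d" "0 < L2"
    "(\<lambda>N. g N * mon n2 N / mon m2 N) \<longlonglongrightarrow> L2"
    and conv: "convergent (\<lambda>N. mon (\<lambda>e. m1 e + n2 e) N / mon (\<lambda>e. n1 e + m2 e) N)"
  shows "monomial_like E r d (\<lambda>N. f N + g N)"
proof -
  obtain l where l: "(\<lambda>N. mon (\<lambda>e. m1 e + n2 e) N / mon (\<lambda>e. n1 e + m2 e) N) \<longlonglongrightarrow> l"
    using conv by (auto simp: convergent_def)
  have "0 \<le> l"
    by (rule LIMSEQ_le_const[OF l]) (use mon_pos in \<open>auto intro!: exI[of _ 1] divide_nonneg_nonneg less_imp_le\<close>)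
  then have "0 < L1 * l + L2" using f g by (simp add: add_nonneg_pos)
  moreover have "(\<lambda>N. (f N + g N) * mon n2 N / mon m2 N) \<longlonglongrightarrow> L1 * l + L2"
    by (rule LIMSEQ_cong_pos[OF tendsto_add[OF tendsto_mult[OF f(4) l] g(4)]])
      (use mon_pos in \<open>simp add: edge_monomial_add field_simps less_imp_neq[symmetric]\<close>)
  ultimately show ?thesis using f g by (intro monomial_likeI) (auto intro: add_pos_pos)
qed

sublocale positive_class "monomial_like E r" "{N. N > 0}"
proof
  fix d e :: int and f g :: "nat \<Rightarrow> real"
  show "0 < f N" if "monomial_like E r d f" "N \<in> {N. N > 0}" for N
    using that by (auto simp: monomial_like_def)
  show "monomial_like E r d g" if f: "monomial_like E r d f" and eq: "\<And>N. N \<in> {N. N > 0} \<Longrightarrow> f N = g N"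
  proof -
    obtain m n L where *: "\<forall>N>0. 0 < f N" "int (\<Sum>e\<in>E. m e) - int (\<Sum>e\<in>E. n e) = d" "0 < L"
      "(\<lambda>N. f N * mon n N / mon m N) \<longlonglongrightarrow> L" using f by (rule monomial_likeE)
    have "(\<lambda>N. g N * mon n N / mon m N) \<longlonglongrightarrow> L"
      by (rule LIMSEQ_cong_pos[OF *(4)]) (use eq in simp)
    then show ?thesis using * eq by (intro monomial_likeI) auto
  qed
  show "monomial_like E r 0 (\<lambda>_. 1)"
    by (rule monomial_likeI[of _ "\<lambda>_. 0" "\<lambda>_. 0" _ 1]) (auto simp: edge_monomial_def)
  assume f: "monomial_like E r d f"
  obtain m1 n1 L1 where 1: "\<forall>N>0. 0 < f N" "int (\<Sum>e\<in>E. m1 e) - int (\<Sum>e\<in>E. n1 e) = d" "0 < L1"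
    "(\<lambda>N. f N * mon n1 N / mon m1 N) \<longlonglongrightarrow> L1" using f by (rule monomial_likeE)
  show "monomial_like E r d (\<lambda>N. f N + g N)" if g: "monomial_like E r d g"
  proof -
    obtain m2 n2 L2 where 2: "\<forall>N>0. 0 < g N" "int (\<Sum>e\<in>E. m2 e) - int (\<Sum>e\<in>E. n2 e) = d" "0 < L2"
      "(\<lambda>N. g N * mon n2 N / mon m2 N) \<longlonglongrightarrow> L2" using g by (rule monomial_likeE)
    note f' = 1 and g' = 2
    have "(\<Sum>e\<in>E. m1 e + n2 e) = (\<Sum>e\<in>E. n1 e + m2 e)"
      using 1(2) 2(2) unfolding sum.distrib by linarith
    from mon_ratio_cases[OF this]
    consider "convergent (\<lambda>N. mon (\<lambda>e. m1 e + n2 e) N / mon (\<lambda>e. n1 e + m2 e) N)"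
      | "convergent (\<lambda>N. mon (\<lambda>e. m2 e + n1 e) N / mon (\<lambda>e. n2 e + m1 e) N)"
      by (auto simp: add.commute)
    then show ?thesis
    proof cases
      case 1
      then show ?thesis by (rule monomial_like_add_aux[OF f' g'])
    next
      case 2
      then have "monomial_like E r d (\<lambda>N. g N + f N)" by (rule monomial_like_add_aux[OF g' f'])
      then show ?thesis by (simp add: add.commute)
    qed
  qed
  assume g: "monomial_like E r e g"
  obtain m2 n2 L2 where 2: "\<forall>N>0. 0 < g N" "int (\<Sum>e\<in>E. m2 e) - int (\<Sum>e\<in>E. n2 e) = e" "0 < L2"
    "(\<lambda>N. g N * mon n2 N / mon m2 N) \<longlonglongrightarrow> L2" using g by (rule monomial_likeE)
  show "monomial_like E r (d + e) (\<lambda>N. f N * g N)"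
  proof (rule monomial_likeI)
    show "int (\<Sum>e\<in>E. m1 e + m2 e) - int (\<Sum>e\<in>E. n1 e + n2 e) = d + e"
      using 1(2) 2(2) by (simp add: sum.distrib)
    show "(\<lambda>N. f N * g N * mon (\<lambda>e. n1 e + n2 e) N / mon (\<lambda>e. m1 e + m2 e) N) \<longlonglongrightarrow> L1 * L2"
      by (rule LIMSEQ_cong_pos[OF tendsto_mult[OF 1(4) 2(4)]]) (simp add: edge_monomial_add)
  qed (use 1 2 in auto)
  show "monomial_like E r (d - e) (\<lambda>N. f N / g N)"
  proof (rule monomial_likeI)
    show "int (\<Sum>e\<in>E. m1 e + n2 e) - int (\<Sum>e\<in>E. n1 e + m2 e) = d - e"
      using 1(2) 2(2) by (simp add: sum.distrib)
    show "(\<lambda>N. f N / g N * mon (\<lambda>e. n1 e + m2 e) N / mon (\<lambda>e. m1 e + n2 e) N) \<longlonglongrightarrow> L1 / L2"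
      by (rule LIMSEQ_cong_pos[OF tendsto_divide[OF 1(4) 2(4)]])
        (use 2(3) in \<open>simp_all add: edge_monomial_add ac_simps\<close>)
  qed (use 1 2 in auto)
qed

lemma monomial_like_rate:
  assumes "(x, y) \<in> E"
  shows "monomial_like E r 1 (\<lambda>N. r N x y)"
proof (rule monomial_likeI)
  let ?m = "\<lambda>e. if e = (x, y) then 1 else 0 :: nat"
  show "int (\<Sum>e\<in>E. ?m e) - int (\<Sum>e\<in>E. 0) = 1" using finE assms by simp
  have "mon ?m N = r N x y" for N
  proof -
    have "mon ?m N = (\<Prod>e\<in>E. if e = (x, y) then r N x y else 1)"
      unfolding edge_monomial_def by (rule prod.cong) (auto split: if_splits)
    then show ?thesis using finE assms by simp
  qed
  then show "(\<lambda>N. r N x y * mon (\<lambda>_. 0) N / mon ?m N) \<longlonglongrightarrow> 1"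
    using rate_pos[OF _ assms]
    by (intro LIMSEQ_cong_pos[OF tendsto_const]) (simp add: edge_monomial_def less_imp_neq[symmetric])
qed (use rate_pos assms in auto)

text \<open>In degree \<open>0\<close> the comparison of the two monomials leaves only convergence
  or divergence to infinity, the latter expressed through the reciprocal.\<close>

lemma monomial_like_cases:
  assumes "monomial_like E r 0 f"
  shows "convergent f \<or> (\<lambda>N. 1 / f N) \<longlonglongrightarrow> 0"
proof -
  obtain m n L where *: "\<forall>N>0. 0 < f N" "int (\<Sum>e\<in>E. m e) - int (\<Sum>e\<in>E. n e) = 0" "0 < L"
    "(\<lambda>N. f N * mon n N / mon m N) \<longlonglongrightarrow> L" using assms by (rule monomial_likeE)
  have "(\<Sum>e\<in>E. m e) = (\<Sum>e\<in>E. n e)" using *(2) by linarith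
  from mon_ratio_cases[OF this] show ?thesis
  proof
    assume "convergent (\<lambda>N. mon m N / mon n N)"
    then obtain l where "(\<lambda>N. mon m N / mon n N) \<longlonglongrightarrow> l" by (auto simp: convergent_def)
    from LIMSEQ_cong_pos[OF tendsto_mult[OF *(4) this], of f] have "f \<longlonglongrightarrow> L * l"
      using mon_pos by (auto simp: less_imp_neq[symmetric])
    then show ?thesis by (auto simp: convergent_def)
  next
    assume "convergent (\<lambda>N. mon n N / mon m N)"
    then obtain l where l: "(\<lambda>N. mon n N / mon m N) \<longlonglongrightarrow> l" by (auto simp: convergent_def)
    show ?thesis
    proof (cases "l = 0")
      case True
      have "(\<lambda>N. (mon n N / mon m N) / (f N * mon n N / mon m N)) \<longlonglongrightarrow> l / L"
        using l *(3,4) by (intro tendsto_divide) auto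
      from LIMSEQ_cong_pos[OF this, of "\<lambda>N. 1 / f N"] show ?thesis
        using mon_pos True by (auto simp: less_imp_neq[symmetric])
    next
      case False
      from LIMSEQ_cong_pos[OF tendsto_divide[OF *(4) l False], of f] have "f \<longlonglongrightarrow> L / l"
        using mon_pos by (auto simp: less_imp_neq[symmetric])
      then show ?thesis by (auto simp: convergent_def)
    qed
  qed
qed

lemma bounded_monomial_like_convergent:
  assumes f: "monomial_like E r 0 f" and b: "\<And>N. N > 0 \<Longrightarrow> f N \<le> C"
  shows "convergent f"
proof (rule ccontr)
  assume "\<not> convergent f"
  then have lim: "(\<lambda>N. 1 / f N) \<longlonglongrightarrow> 0" using monomial_like_cases[OF f] by simp
  have pos: "0 < f N" if "N > 0" for N using K_pos[OF f] that by simp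
  have C: "0 < C" using pos[of 1] b[of 1] by simp
  have "1 / C \<le> 0"
    by (rule LIMSEQ_le_const[OF lim], rule exI[of _ 1]) (use b pos C in \<open>simp add: frac_le\<close>)
  then show False using C by simp
qed

end

section \<open>Relative perturbations of the rates\<close>

text \<open>A pair of functions is encoded as one function on \<open>nat \<times> bool\<close>, so that the elimination
  argument treats a chain and its perturbation simultaneously.\<close>

definition equiv_pair :: "int \<Rightarrow> (nat \<times> bool \<Rightarrow> real) \<Rightarrow> bool" where
  "equiv_pair d f \<longleftrightarrow> (\<forall>N>0. \<forall>b. 0 < f (N, b)) \<and> (\<lambda>N. f (N, True) / f (N, False)) \<longlonglongrightarrow> 1"

text \<open>The quotient of the sums differs from \<open>1\<close> by a convex combination of the two errors.\<close>

lemma tendsto_quotient_sum: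
  fixes a b c d :: "nat \<Rightarrow> real"
  assumes pos: "\<And>N. N > 0 \<Longrightarrow> 0 < b N" "\<And>N. N > 0 \<Longrightarrow> 0 < d N"
    and lim: "(\<lambda>N. a N / b N) \<longlonglongrightarrow> 1" "(\<lambda>N. c N / d N) \<longlonglongrightarrow> 1"
  shows "(\<lambda>N. (a N + c N) / (b N + d N)) \<longlonglongrightarrow> 1"
proof -
  let ?e = "\<lambda>N. \<bar>a N / b N - 1\<bar> + \<bar>c N / d N - 1\<bar>"
  have "(\<lambda>N. \<bar>a N / b N - 1\<bar> + \<bar>c N / d N - 1\<bar>) \<longlonglongrightarrow> \<bar>1 - 1\<bar> + \<bar>1 - 1\<bar>"
    by (intro tendsto_intros lim)
  then have e: "?e \<longlonglongrightarrow> 0" by simp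
  have "(\<lambda>N. (a N + c N) / (b N + d N) - 1) \<longlonglongrightarrow> 0"
  proof (rule Lim_null_comparison[OF _ e], rule eventually_sequentiallyI[of 1])
    fix N :: nat assume "1 \<le> N"
    then have b: "0 < b N" and d: "0 < d N" using pos by auto
    have "(a N + c N) / (b N + d N) - 1 =
        b N / (b N + d N) * (a N / b N - 1) + d N / (b N + d N) * (c N / d N - 1)"
    proof -
      have "a N / b N - 1 = (a N - b N) / b N" "c N / d N - 1 = (c N - d N) / d N"
        using b d by (simp_all add: diff_divide_distrib)
      then have "b N / (b N + d N) * (a N / b N - 1) = (a N - b N) / (b N + d N)"
        "d N / (b N + d N) * (c N / d N - 1) = (c N - d N) / (b N + d N)"
        using b d by simp_all
      moreover have "(a N + c N) / (b N + d N) - 1 = (a N - b N + (c N - d N)) / (b N + d N)"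
        using b d by (simp add: field_simps)
      ultimately show ?thesis by (metis add_divide_distrib)
    qed
    also have "\<bar>\<dots>\<bar> \<le> b N / (b N + d N) * \<bar>a N / b N - 1\<bar> + d N / (b N + d N) * \<bar>c N / d N - 1\<bar>"
      using b d by (intro order_trans[OF abs_triangle_ineq]) (simp add: abs_mult)
    also have "\<dots> \<le> 1 * \<bar>a N / b N - 1\<bar> + 1 * \<bar>c N / d N - 1\<bar>"
      using b d by (intro add_mono mult_right_mono) auto
    finally show "norm ((a N + c N) / (b N + d N) - 1) \<le> ?e N" by simp
  qed
  then show ?thesis by (simp add: LIM_zero_iff)
qed

interpretation equiv_pair: positive_class equiv_pair "{N. N > 0} \<times> UNIV"
proof
  fix d e :: int and f g :: "nat \<times> bool \<Rightarrow> real"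
  show "0 < f i" if "equiv_pair d f" "i \<in> {N. N > 0} \<times> UNIV" for i
    using that by (auto simp: equiv_pair_def)
  show "equiv_pair d g" if "equiv_pair d f" "\<And>i. i \<in> {N. N > 0} \<times> UNIV \<Longrightarrow> f i = g i"
    using that LIMSEQ_cong_pos[of "\<lambda>N. f (N, True) / f (N, False)" 1 "\<lambda>N. g (N, True) / g (N, False)"]
    by (auto simp: equiv_pair_def)
  show "equiv_pair 0 (\<lambda>_. 1)" by (simp add: equiv_pair_def)
  assume f: "equiv_pair d f"
  show "equiv_pair d (\<lambda>i. f i + g i)" if "equiv_pair d g"
    using f that by (auto simp: equiv_pair_def intro!: tendsto_quotient_sum add_pos_pos)
  assume g: "equiv_pair e g"
  show "equiv_pair (d + e) (\<lambda>i. f i * g i)"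
    using f g tendsto_mult[of "\<lambda>N. f (N, True) / f (N, False)" 1 _ "\<lambda>N. g (N, True) / g (N, False)" 1]
    by (auto simp: equiv_pair_def)
  show "equiv_pair (d - e) (\<lambda>i. f i / g i)"
    using f g tendsto_divide[of "\<lambda>N. f (N, True) / f (N, False)" 1 _ "\<lambda>N. g (N, True) / g (N, False)" 1]
    by (auto simp: equiv_pair_def divide_divide_eq_left divide_divide_eq_right ac_simps)
qed

section \<open>Fast classes and the rescaled limit\<close>

locale rate_family =
  fixes V :: "'v set" and E :: "('v \<times> 'v) set" and r :: "nat \<Rightarrow> 'v \<Rightarrow> 'v \<Rightarrow> real"
  assumes finV: "finite V" and V_ne: "V \<noteq> {}" and E_sub: "E \<subseteq> V \<times> V"
    and strongly_connected: "\<And>x y. x \<in> V \<Longrightarrow> y \<in> V \<Longrightarrow> (x, y) \<in> E\<^sup>*"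
    and pos: "\<And>N x y. N > 0 \<Longrightarrow> (x, y) \<in> E \<Longrightarrow> r N x y > 0"
    and zero: "\<And>N x y. N > 0 \<Longrightarrow> (x, y) \<notin> E \<Longrightarrow> r N x y = 0"
    and comparable: "assumption_A E r"

sublocale rate_family \<subseteq> comparable_rates E r
  by unfold_locales (use finV finite_subset[OF E_sub] pos comparable in simp_all)

context rate_family
begin

lemma nonneg: "N > 0 \<Longrightarrow> 0 \<le> r N x y"
  using pos[of N x y] zero[of N x y] by (cases "(x, y) \<in> E") auto

lemma rate_ne: "N > 0 \<Longrightarrow> (x, y) \<in> E \<Longrightarrow> r N x y \<noteq> 0"
  using pos[of N x y] by simp

lemma rate_pos_iff: "N > 0 \<Longrightarrow> 0 < r N x y \<longleftrightarrow> (x, y) \<in> E"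
  using pos[of N x y] zero[of N x y] by force

lemma support_graph_rates: "N > 0 \<Longrightarrow> support_graph V (r N) = E"
  unfolding support_graph_def using E_sub by (auto simp: rate_pos_iff)

abbreviation F :: "('v \<times> 'v) set" where "F \<equiv> fast_edges E r"
abbreviation A :: "'v set" where "A \<equiv> V_hat V E r"
abbreviation MM :: "'v set set" where "MM \<equiv> minimal_classes V E r"

lemma F_sub: "F \<subseteq> E" by (auto simp: fast_edges_def)

text \<open>Comparison of edge rates is total by \<open>monomial_like_cases\<close> and transitive
  by multiplying limits, so a finite nonempty set has a greatest element.\<close>

lemma exists_dominant:
  assumes "finite S" "S \<noteq> {}" "S \<subseteq> E"
  shows "\<exists>x0 y0. (x0, y0) \<in> S \<and> (\<forall>x y. (x, y) \<in> S \<longrightarrow> convergent (\<lambda>N. r N x y / r N x0 y0))"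
  using assms
proof (induction S rule: finite_ne_induct)
  case (singleton e)
  obtain x y where e: "e = (x, y)" by (cases e)
  have "(\<lambda>N. r N x y / r N x y) \<longlonglongrightarrow> 1"
    by (rule LIMSEQ_cong_pos[OF tendsto_const]) (use singleton e in \<open>simp add: rate_ne\<close>)
  then have "convergent (\<lambda>N. r N x y / r N x y)" by (rule convergentI)
  then show ?case unfolding e by (intro exI[of _ x] exI[of _ y]) fastforce
next
  case (insert e S)
  obtain x1 y1 where e: "e = (x1, y1)" by (cases e)
  obtain x0 y0 where 0: "(x0, y0) \<in> S" "\<And>x y. (x, y) \<in> S \<Longrightarrow> convergent (\<lambda>N. r N x y / r N x0 y0)"
    using insert.IH insert.prems by blast
  have E: "(x0, y0) \<in> E" "(x1, y1) \<in> E" using insert 0 e by auto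
  have "monomial_like E r 0 (\<lambda>N. r N x1 y1 / r N x0 y0)"
    using K_divide[OF monomial_like_rate[OF E(2)] monomial_like_rate[OF E(1)]] by simp
  from monomial_like_cases[OF this] show ?case
  proof
    assume "convergent (\<lambda>N. r N x1 y1 / r N x0 y0)"
    then show ?case using 0 e by (intro exI[of _ x0] exI[of _ y0]) blast
  next
    assume "(\<lambda>N. 1 / (r N x1 y1 / r N x0 y0)) \<longlonglongrightarrow> 0"
    then have inv: "convergent (\<lambda>N. r N x0 y0 / r N x1 y1)" by (auto simp: convergent_def)
    have c: "convergent (\<lambda>N. r N x y / r N x1 y1)" if xy: "(x, y) \<in> insert e S" for x y
    proof (cases "(x, y) = e")
      case True
      have "(\<lambda>N. r N x y / r N x1 y1) \<longlonglongrightarrow> 1"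
        by (rule LIMSEQ_cong_pos[OF tendsto_const]) (use True e E in \<open>simp add: rate_ne\<close>)
      then show ?thesis by (auto simp: convergent_def)
    next
      case False
      then have "convergent (\<lambda>N. r N x y / r N x0 y0)" using 0 xy by auto
      then obtain l l' where l: "(\<lambda>N. r N x y / r N x0 y0) \<longlonglongrightarrow> l"
        "(\<lambda>N. r N x0 y0 / r N x1 y1) \<longlonglongrightarrow> l'" using inv by (auto simp: convergent_def)
      have "(\<lambda>N. r N x y / r N x1 y1) \<longlonglongrightarrow> l * l'"
        by (rule LIMSEQ_cong_pos[OF tendsto_mult[OF l]]) (use E in \<open>simp add: rate_ne\<close>)
      then show ?thesis by (auto simp: convergent_def)
    qed
    show ?case
    proof (intro exI conjI allI impI)
      show "(x1, y1) \<in> insert e S" by (simp add: e)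
      show "convergent (\<lambda>N. r N x y / r N x1 y1)" if "(x, y) \<in> insert e S" for x y
        using that by (rule c)
    qed
  qed
qed

text \<open>The scale is the rate of a dominant edge. An edge with positive limit dominates every
  other, by dividing limits; for a fast edge the reciprocal ratio converges too, so its limit cannot
  be \<open>0\<close>.\<close>

lemma exists_scale:
  "\<exists>s \<rho>. (\<forall>N>0. 0 < s N) \<and> (\<forall>x y. (\<lambda>N. r N x y / s N) \<longlonglongrightarrow> \<rho> x y) \<and>
     (\<forall>x y. 0 \<le> \<rho> x y) \<and> (\<forall>x y. 0 < \<rho> x y \<longleftrightarrow> (x, y) \<in> F)"
proof (cases "E = {}")
  \<comment> \<open>Without edges no rate is available as a scale; by strong connectivity this is
    the case of a single state.\<close>
  case True
  have "(\<lambda>N. r N x y / 1) \<longlonglongrightarrow> 0" for x y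
    by (rule LIMSEQ_cong_pos[OF tendsto_const]) (use zero True in auto)
  then show ?thesis
    by (intro exI[of _ "\<lambda>_. 1"] exI[of _ "\<lambda>_ _. 0"]) (auto simp: fast_edges_def True)
next
  case False
  obtain x0 y0 where 0: "(x0, y0) \<in> E" "\<And>x y. (x, y) \<in> E \<Longrightarrow> convergent (\<lambda>N. r N x y / r N x0 y0)"
    using exists_dominant[OF finE False] by blast
  define s where "s N = r N x0 y0" for N
  have s: "0 < s N" if "N > 0" for N using pos 0 that by (simp add: s_def)
  have "\<exists>l. (\<lambda>N. r N x y / s N) \<longlonglongrightarrow> l" for x y
  proof (cases "(x, y) \<in> E")
    case True
    then show ?thesis using 0 by (auto simp: convergent_def s_def)
  next
    case False
    have "(\<lambda>N. r N x y / s N) \<longlonglongrightarrow> 0"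
      by (rule LIMSEQ_cong_pos[OF tendsto_const]) (use zero False in auto)
    then show ?thesis by blast
  qed
  then obtain \<rho> where \<rho>: "\<And>x y. (\<lambda>N. r N x y / s N) \<longlonglongrightarrow> \<rho> x y" by metis
  have ge: "0 \<le> \<rho> x y" for x y
    by (rule LIMSEQ_le_const[OF \<rho>]) (use s nonneg in \<open>auto intro!: exI[of _ 1] divide_nonneg_pos\<close>)
  have "0 < \<rho> x y \<longleftrightarrow> (x, y) \<in> F" for x y
  proof
    assume gt: "0 < \<rho> x y"
    have xy: "(x, y) \<in> E"
    proof (rule ccontr)
      assume "(x, y) \<notin> E"
      then have "(\<lambda>N. 0) \<longlonglongrightarrow> \<rho> x y" by (intro LIMSEQ_cong_pos[OF \<rho>]) (simp add: zero)
      then show False using gt LIMSEQ_unique[OF tendsto_const] by force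
    qed
    have "convergent (\<lambda>N. r N x' y' / r N x y)" if "(x', y') \<in> E" for x' y'
    proof -
      have "(\<lambda>N. r N x' y' / r N x y) \<longlonglongrightarrow> \<rho> x' y' / \<rho> x y"
      proof (rule LIMSEQ_cong_pos[OF tendsto_divide[OF \<rho> \<rho>]])
        show "\<rho> x y \<noteq> 0" using gt by simp
        show "r N x' y' / s N / (r N x y / s N) = r N x' y' / r N x y" if "N > 0" for N
          using s[OF that] by simp
      qed
      then show ?thesis by (auto simp: convergent_def)
    qed
    then show "(x, y) \<in> F" using xy by (auto simp: fast_edges_def)
  next
    assume xy: "(x, y) \<in> F"
    then have xyE: "(x, y) \<in> E" and "convergent (\<lambda>N. s N / r N x y)"
      using 0 by (auto simp: fast_edges_def s_def)
    then obtain l where "(\<lambda>N. s N / r N x y) \<longlonglongrightarrow> l" by (auto simp: convergent_def)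
    from tendsto_mult[OF \<rho>[of x y] this] have "(\<lambda>N. 1) \<longlonglongrightarrow> \<rho> x y * l"
      by (rule LIMSEQ_cong_pos) (use s xyE in \<open>simp add: rate_ne less_imp_neq[symmetric]\<close>)
    then have "\<rho> x y * l = 1" using LIMSEQ_unique[OF tendsto_const] by force
    then show "0 < \<rho> x y" using ge[of x y] by (cases "\<rho> x y = 0") auto
  qed
  then show ?thesis using s \<rho> ge by blast
qed

section \<open>Structure of the minimal classes\<close>

definition class_rel :: "('v \<times> 'v) set" where
  "class_rel = {(x, y) \<in> V \<times> V. (x, y) \<in> F\<^sup>* \<and> (y, x) \<in> F\<^sup>*}"

lemma fast_classes_eq: "fast_classes V E r = V // class_rel"
  by (simp add: fast_classes_def class_rel_def)

lemma equiv_class_rel: "equiv V class_rel"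
proof (rule equivI)
  show "class_rel \<subseteq> V \<times> V" by (auto simp: class_rel_def)
  show "refl_on V class_rel" by (auto simp: refl_on_def class_rel_def)
  show "sym class_rel" by (auto simp: sym_def class_rel_def)
  show "trans class_rel" unfolding trans_def class_rel_def by (blast intro: rtrancl_trans)
qed

lemma MM_fast_class: "M \<in> MM \<Longrightarrow> M \<in> V // class_rel"
  by (simp add: minimal_classes_def fast_classes_eq)

lemma finite_MM: "finite MM"
proof (rule finite_subset)
  show "MM \<subseteq> V // class_rel" using MM_fast_class by blast
  show "finite (V // class_rel)" by (rule finite_quotient[OF finV]) (auto simp: class_rel_def)
qed

lemma MM_sub: "M \<in> MM \<Longrightarrow> M \<subseteq> V"
  using in_quotient_imp_subset[OF equiv_class_rel MM_fast_class] .

lemma MM_ne: "M \<in> MM \<Longrightarrow> M \<noteq> {}"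
  using in_quotient_imp_non_empty[OF equiv_class_rel MM_fast_class] .

lemma MM_finite: "M \<in> MM \<Longrightarrow> finite M"
  using MM_sub finV finite_subset by blast

lemma MM_disjoint: "M \<in> MM \<Longrightarrow> M' \<in> MM \<Longrightarrow> M \<noteq> M' \<Longrightarrow> M \<inter> M' = {}"
  using quotient_disj[OF equiv_class_rel MM_fast_class MM_fast_class] by blast

lemma MM_reach:
  assumes "M \<in> MM" "x \<in> M" "y \<in> M"
  shows "(x, y) \<in> F\<^sup>*"
proof -
  obtain v where "M = class_rel `` {v}" using MM_fast_class[OF assms(1)] by (rule quotientE)
  then have "(x, v) \<in> F\<^sup>*" "(v, y) \<in> F\<^sup>*" using assms by (auto simp: class_rel_def)
  then show ?thesis by (rule rtrancl_trans)
qed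

lemma MM_closed: "M \<in> MM \<Longrightarrow> x \<in> M \<Longrightarrow> (x, y) \<in> F \<Longrightarrow> y \<in> M"
  using F_sub E_sub by (auto simp: minimal_classes_def)

lemma MM_reach_inside:
  assumes M: "M \<in> MM" and xy: "x \<in> M" "y \<in> M"
  shows "(x, y) \<in> (F \<inter> M \<times> M)\<^sup>*"
proof -
  have "y \<in> M \<and> (x, y) \<in> (F \<inter> M \<times> M)\<^sup>*" using MM_reach[OF assms]
  proof (induction rule: rtrancl_induct)
    case (step y z)
    then have "(y, z) \<in> F \<inter> M \<times> M" using MM_closed[OF M] by blast
    then show ?case using step.IH by (auto intro: rtrancl_into_rtrancl)
  qed (use xy in auto)
  then show ?thesis ..
qed

lemma A_sub: "A \<subseteq> V"
  using MM_sub by (auto simp: V_hat_def)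

lemma finite_A: "finite A"
  using A_sub finV finite_subset by blast

lemma A_closed: "x \<in> A \<Longrightarrow> (x, y) \<in> F \<Longrightarrow> y \<in> A"
  using MM_closed by (auto simp: V_hat_def)

lemma sum_A: "sum f A = (\<Sum>M\<in>MM. sum f M)" for f :: "'v \<Rightarrow> real"
  unfolding V_hat_def using MM_finite MM_disjoint by (subst sum.Union_disjoint) auto

text \<open>A vertex reachable from \<open>v\<close> whose set of reachable vertices is smallest lies in a minimal
  class.\<close>

lemma reach_A:
  assumes v: "v \<in> V"
  shows "\<exists>u\<in>A. (v, u) \<in> F\<^sup>*"
proof -
  define R where "R u = F\<^sup>* `` {u}" for u
  have RV: "R u \<subseteq> V" if "u \<in> V" for u
  proof
    fix w assume "w \<in> R u"
    then have "(u, w) \<in> F\<^sup>*" by (simp add: R_def)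
    then show "w \<in> V" by (induction rule: rtrancl_induct) (use that F_sub E_sub in auto)
  qed
  obtain u where u: "u \<in> R v" "\<And>w. w \<in> R v \<Longrightarrow> card (R u) \<le> card (R w)"
    using ex_has_least_nat[of "\<lambda>u. u \<in> R v" v "\<lambda>u. card (R u)"] by (auto simp: R_def)
  have uV: "u \<in> V" using u RV[OF v] by auto
  have returns: "(w, u) \<in> F\<^sup>*" if "w \<in> R u" for w
  proof -
    have "R w \<subseteq> R u" "w \<in> R v" using that u(1) by (auto simp: R_def intro: rtrancl_trans)
    then have "R w = R u"
      using u(2)[of w] RV[OF uV] finV by (intro card_seteq) (auto intro: finite_subset)
    then show ?thesis by (auto simp: R_def)
  qed
  have "class_rel `` {u} = R u"
    using returns RV[OF uV] uV by (auto simp: class_rel_def R_def)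
  moreover have "class_rel `` {u} \<in> fast_classes V E r"
    unfolding fast_classes_eq using uV by (rule quotientI)
  moreover have "(x, y) \<notin> F" if "x \<in> R u" "y \<in> V - R u" for x y
    using that by (auto simp: R_def intro: rtrancl_into_rtrancl)
  ultimately have "R u \<in> MM" by (auto simp: minimal_classes_def)
  then have "u \<in> A" by (auto simp: V_hat_def R_def)
  then show ?thesis using u by (auto simp: R_def)
qed

lemma A_ne: "A \<noteq> {}"
  using reach_A V_ne by blast

lemma MM_ne': "MM \<noteq> {}"
  using A_ne by (auto simp: V_hat_def)

section \<open>Limits of the invariant measures\<close>

definition st :: "nat \<Rightarrow> 'v \<Rightarrow> real" where
  "st N = pmf (inv_measure V (r N))"

lemmas st_class_facts = finV V_ne E_sub monomial_like_rate zero strongly_connected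

lemma st_invariant: "N > 0 \<Longrightarrow> invariant_vec V (r N) (st N)"
  unfolding st_def by (rule inv_measure_invariant[where r = r, OF st_class_facts]) auto

lemma st_pos: "N > 0 \<Longrightarrow> x \<in> V \<Longrightarrow> 0 < st N x"
  unfolding st_def by (rule inv_measure_pos[where r = r, OF st_class_facts]) auto

lemma st_outside: "N > 0 \<Longrightarrow> x \<notin> V \<Longrightarrow> st N x = 0"
  unfolding st_def by (rule inv_measure_outside[where r = r, OF st_class_facts]) auto

lemma st_sum: "N > 0 \<Longrightarrow> sum (st N) V = 1"
  unfolding st_def by (rule inv_measure_sum[where r = r, OF st_class_facts]) auto

lemma share_convergent:
  assumes S: "finite S" "x \<in> S" and p: "\<And>N y. N > 0 \<Longrightarrow> y \<in> S \<Longrightarrow> 0 < p N y"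
    and K: "monomial_like E r 0 (\<lambda>N. p N x / sum (p N) S)"
  shows "convergent (\<lambda>N. p N x / sum (p N) S)"
proof (rule bounded_monomial_like_convergent[OF K])
  fix N :: nat assume N: "N > 0"
  have "0 < sum (p N) S" using S p N by (intro sum_pos) auto
  moreover have "p N x \<le> sum (p N) S" using S p N by (intro member_le_sum) (auto intro: less_imp_le)
  ultimately show "p N x / sum (p N) S \<le> 1" by simp
qed

text \<open>\<open>S = V\<close> gives convergence of the weights themselves; a minimal class as
  \<open>S\<close> gives convergence of conditional laws, even if the mass of the class tends to
  \<open>0\<close>.\<close>

lemma st_share_convergent:
  assumes "S \<subseteq> V" "x \<in> S"
  shows "convergent (\<lambda>N. st N x / sum (st N) S)"
proof (rule share_convergent)
  show "finite S" using assms finV finite_subset by blast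
  show "monomial_like E r 0 (\<lambda>N. st N x / sum (st N) S)"
    unfolding st_def using assms by (intro inv_measure_share[where r = r, OF st_class_facts]) auto
qed (use assms st_pos in auto)

definition scale :: "(nat \<Rightarrow> real) \<times> ('v \<Rightarrow> 'v \<Rightarrow> real)" where
  "scale = (SOME (s, \<rho>). (\<forall>N>0. 0 < s N) \<and> (\<forall>x y. (\<lambda>N. r N x y / s N) \<longlonglongrightarrow> \<rho> x y) \<and>
     (\<forall>x y. 0 \<le> \<rho> x y) \<and> (\<forall>x y. 0 < \<rho> x y \<longleftrightarrow> (x, y) \<in> F))"

abbreviation s :: "nat \<Rightarrow> real" where "s \<equiv> fst scale"
abbreviation \<rho> :: "'v \<Rightarrow> 'v \<Rightarrow> real" where "\<rho> \<equiv> snd scale"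

lemma scale:
  shows s_pos: "N > 0 \<Longrightarrow> 0 < s N" and \<rho>: "(\<lambda>N. r N x y / s N) \<longlonglongrightarrow> \<rho> x y"
    and \<rho>_nonneg: "0 \<le> \<rho> x y" and \<rho>_pos: "0 < \<rho> x y \<longleftrightarrow> (x, y) \<in> F"
proof -
  let ?P = "\<lambda>(s, \<rho>). (\<forall>N>0. 0 < s N) \<and> (\<forall>x y. (\<lambda>N. r N x y / s N) \<longlonglongrightarrow> \<rho> x y) \<and>
     (\<forall>x y. 0 \<le> \<rho> x y) \<and> (\<forall>x y. 0 < \<rho> x y \<longleftrightarrow> (x, y) \<in> F)"
  have "?P scale" unfolding scale_def using exists_scale by (intro someI_ex[of ?P]) auto
  then show "N > 0 \<Longrightarrow> 0 < s N" "(\<lambda>N. r N x y / s N) \<longlonglongrightarrow> \<rho> x y" "0 \<le> \<rho> x y"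
    "0 < \<rho> x y \<longleftrightarrow> (x, y) \<in> F" by (auto simp: case_prod_unfold)
qed

lemma \<rho>_zero: "(x, y) \<notin> F \<Longrightarrow> \<rho> x y = 0"
  using \<rho>_nonneg[of x y] \<rho>_pos[of x y] by auto

definition st_lim :: "'v \<Rightarrow> real" where "st_lim x = lim (\<lambda>N. st N x)"

lemma st_tendsto: "(\<lambda>N. st N x) \<longlonglongrightarrow> st_lim x"
proof -
  have "\<exists>l. (\<lambda>N. st N x) \<longlonglongrightarrow> l"
  proof (cases "x \<in> V")
    case True
    then obtain l where "(\<lambda>N. st N x / sum (st N) V) \<longlonglongrightarrow> l"
      using st_share_convergent by (auto simp: convergent_def)
    then have "(\<lambda>N. st N x) \<longlonglongrightarrow> l" by (rule LIMSEQ_cong_pos) (simp add: st_sum)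
    then show ?thesis by blast
  next
    case False
    have "(\<lambda>N. st N x) \<longlonglongrightarrow> 0"
      by (rule LIMSEQ_cong_pos[OF tendsto_const]) (simp add: st_outside False)
    then show ?thesis by blast
  qed
  then show ?thesis unfolding st_lim_def by (metis convergentI convergent_LIMSEQ_iff)
qed

lemma st_lim_nonneg: "0 \<le> st_lim x"
  by (rule LIMSEQ_le_const[OF st_tendsto]) (simp add: st_def)

lemma st_lim_outside_V: "x \<notin> V \<Longrightarrow> st_lim x = 0"
  using LIMSEQ_cong_pos[OF st_tendsto[of x] st_outside] LIMSEQ_unique[OF tendsto_const] by metis

lemma st_lim_sum: "sum st_lim V = 1"
proof -
  have "(\<lambda>N. sum (st N) V) \<longlonglongrightarrow> sum st_lim V" by (intro tendsto_intros st_tendsto)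
  from LIMSEQ_cong_pos[OF this st_sum] show ?thesis using LIMSEQ_unique[OF tendsto_const] by metis
qed

text \<open>An inequality is passed to the limit because conditioning on \<open>S\<close> discards
  inflow from \<open>W - S\<close>, while outflow to all of \<open>W\<close> is still
  counted.\<close>

lemma limit_balance_le:
  assumes q: "\<And>x. x \<in> S \<Longrightarrow> (\<lambda>N. q N x) \<longlonglongrightarrow> ql x" and S: "S \<subseteq> W" "finite W" and y: "y \<in> S"
    and k: "\<And>x y. x \<in> W \<Longrightarrow> y \<in> W \<Longrightarrow> (\<lambda>N. k N x y / s N) \<longlonglongrightarrow> \<rho> x y"
    and bal: "\<And>N. N > 0 \<Longrightarrow> (\<Sum>x\<in>S. q N x * k N x y) \<le> q N y * (\<Sum>x\<in>W. k N y x)"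
  shows "(\<Sum>x\<in>S. ql x * \<rho> x y) \<le> ql y * (\<Sum>x\<in>W. \<rho> y x)"
proof (rule LIMSEQ_le)
  show "(\<lambda>N. \<Sum>x\<in>S. q N x * (k N x y / s N)) \<longlonglongrightarrow> (\<Sum>x\<in>S. ql x * \<rho> x y)"
    by (intro tendsto_intros q k) (use y S in auto)
  show "(\<lambda>N. q N y * (\<Sum>x\<in>W. k N y x / s N)) \<longlonglongrightarrow> ql y * (\<Sum>x\<in>W. \<rho> y x)"
    by (intro tendsto_intros q k) (use y S in auto)
  have "(\<Sum>x\<in>S. q N x * (k N x y / s N)) \<le> q N y * (\<Sum>x\<in>W. k N y x / s N)" if "N > 0" for N
    using divide_right_mono[OF bal[OF that], of "s N"] s_pos[OF that]
    by (simp add: sum_divide_distrib sum_distrib_left)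
  then show "\<exists>N0. \<forall>N\<ge>N0. (\<Sum>x\<in>S. q N x * (k N x y / s N)) \<le> q N y * (\<Sum>x\<in>W. k N y x / s N)"
    by (intro exI[of _ 1]) auto
qed

text \<open>Both sides have the same sum over \<open>S\<close>, so none of the inequalities is strict.\<close>

lemma balance_from_le:
  fixes q :: "'v \<Rightarrow> real"
  assumes S: "finite S" and le: "\<And>y. y \<in> S \<Longrightarrow> (\<Sum>x\<in>S. q x * \<rho> x y) \<le> q y * (\<Sum>x\<in>S. \<rho> y x)"
  shows "invariant_vec S \<rho> q"
proof -
  define d where "d y = q y * (\<Sum>x\<in>S. \<rho> y x) - (\<Sum>x\<in>S. q x * \<rho> x y)" for y
  have "(\<Sum>y\<in>S. \<Sum>x\<in>S. q x * \<rho> x y) = (\<Sum>y\<in>S. q y * (\<Sum>x\<in>S. \<rho> y x))"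
    by (subst sum.swap) (simp add: sum_distrib_left)
  then have "sum d S = 0" by (simp add: d_def sum_subtractf)
  then have "\<forall>y\<in>S. d y = 0" using S le by (subst (asm) sum_nonneg_eq_0_iff) (auto simp: d_def)
  then show ?thesis by (auto simp: invariant_vec_def d_def)
qed

lemma sum_\<rho>_closed:
  assumes "S \<subseteq> V" "\<And>x. (y, x) \<in> F \<Longrightarrow> x \<in> S"
  shows "(\<Sum>x\<in>V. \<rho> y x) = (\<Sum>x\<in>S. \<rho> y x)"
proof (rule sum.mono_neutral_right[OF finV assms(1)])
  show "\<forall>x\<in>V - S. \<rho> y x = 0" using assms(2) \<rho>_zero by blast
qed

lemma st_lim_invariant: "invariant_vec V \<rho> st_lim"
proof (rule balance_from_le[OF finV], rule limit_balance_le[where k = r, OF st_tendsto order_refl finV _ \<rho>])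
  show "(\<Sum>x\<in>V. st N x * r N x y) \<le> st N y * (\<Sum>x\<in>V. r N y x)" if "y \<in> V" "N > 0" for N y
    using st_invariant[OF that(2)] that(1) by (simp add: invariant_vec_def)
qed

lemma support_\<rho>: "support_graph S \<rho> = F \<inter> S \<times> S"
  by (auto simp: support_graph_def \<rho>_pos)

text \<open>\<open>A\<close> is closed under fast edges, so balance summed over \<open>A\<close>
  leaves no room for inflow: the limit vanishes at each outside vertex with a fast edge into
  \<open>A\<close>. From any other outside vertex of \<open>V\<close>, positivity would spread along
  a fast path to such a vertex.\<close>

lemma st_lim_outside: "x \<notin> A \<Longrightarrow> st_lim x = 0"
proof (cases "x \<in> V")
  case True
  assume xA: "x \<notin> A"
  have zA: "st_lim z = 0" if z: "z \<in> V - A" "y \<in> A" "(z, y) \<in> F" for z y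
  proof -
    have eq: "st_lim y * (\<Sum>x\<in>A. \<rho> y x) = (\<Sum>x\<in>V. st_lim x * \<rho> x y)" if "y \<in> A" for y
    proof -
      have "(\<Sum>x\<in>V. \<rho> y x) = (\<Sum>x\<in>A. \<rho> y x)" by (rule sum_\<rho>_closed[OF A_sub A_closed[OF that]])
      moreover have "y \<in> V" using that A_sub by blast
      ultimately show ?thesis
        using bspec[OF st_lim_invariant[unfolded invariant_vec_def]] by metis
    qed
    have "(\<Sum>y\<in>A. \<Sum>x\<in>V. st_lim x * \<rho> x y) = (\<Sum>y\<in>A. st_lim y * (\<Sum>x\<in>A. \<rho> y x))"
      by (rule sum.cong) (simp_all only: eq)
    also have "\<dots> = (\<Sum>x\<in>A. \<Sum>y\<in>A. st_lim x * \<rho> x y)"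
      by (simp only: sum_distrib_left)
    also have "\<dots> = (\<Sum>y\<in>A. \<Sum>x\<in>A. st_lim x * \<rho> x y)" by (rule sum.swap)
    finally have "(\<Sum>y\<in>A. \<Sum>x\<in>V. st_lim x * \<rho> x y) = (\<Sum>y\<in>A. \<Sum>x\<in>A. st_lim x * \<rho> x y)" .
    moreover have "(\<Sum>x\<in>V. f x) = (\<Sum>x\<in>V - A. f x) + (\<Sum>x\<in>A. f x)" for f :: "'v \<Rightarrow> real"
      using sum.subset_diff[OF A_sub finV] .
    ultimately have "(\<Sum>y\<in>A. \<Sum>x\<in>V - A. st_lim x * \<rho> x y) = 0"
      by (simp only: sum.distrib)
    then have "(\<Sum>x\<in>V - A. st_lim x * \<rho> x y) = 0"
      using z(2) finite_A st_lim_nonneg \<rho>_nonneg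
      by (subst (asm) sum_nonneg_eq_0_iff) (auto intro!: sum_nonneg)
    then have "st_lim z * \<rho> z y = 0"
      using z(1) finV st_lim_nonneg \<rho>_nonneg
      by (subst (asm) sum_nonneg_eq_0_iff) (auto intro!: sum_nonneg)
    then show ?thesis using \<rho>_pos[of z y] z(3) by simp
  qed
  obtain u where u: "u \<in> A" "(x, u) \<in> F\<^sup>*" using reach_A[OF True] by auto
  from u(2) xA True show ?thesis
  proof (induction rule: converse_rtrancl_induct)
    case base
    then show ?case using u by simp
  next
    case (step y w)
    have yw: "y \<in> V" "w \<in> V" using step.hyps F_sub E_sub by auto
    show ?case
    proof (cases "w \<in> A")
      case True
      then show ?thesis using zA step yw by auto
    next
      case False
      have "(y, w) \<in> (support_graph V \<rho>)\<^sup>*" using step.hyps yw by (auto simp: support_\<rho>)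
      with invariant_vec_pos[OF finV \<rho>_nonneg st_lim_invariant st_lim_nonneg this]
      have "0 < st_lim y \<Longrightarrow> 0 < st_lim w" by simp
      then show ?thesis using step.IH[OF False] yw st_lim_nonneg[of y] by force
    qed
  qed
qed (use st_lim_outside_V in simp)

section \<open>Invariant measures inside a minimal class\<close>

definition fast_rate :: "'v set \<Rightarrow> nat \<Rightarrow> 'v \<Rightarrow> 'v \<Rightarrow> real" where
  "fast_rate M N x y = (if (x, y) \<in> F \<inter> M \<times> M then r N x y else 0)"

definition mu :: "nat \<Rightarrow> 'v set \<Rightarrow> 'v \<Rightarrow> real" where
  "mu N M = pmf (mu_N E r N M)"

lemma mu_eq: "mu N M = pmf (inv_measure M (fast_rate M N))"
  by (simp add: mu_def mu_N_def fast_rate_def[abs_def])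

context
  fixes M assumes M: "M \<in> MM"
begin

lemma fast_rate_class: "(x, y) \<in> F \<inter> M \<times> M \<Longrightarrow> monomial_like E r 1 (\<lambda>N. fast_rate M N x y)"
  using monomial_like_rate[of x y] F_sub by (auto simp: fast_rate_def)

lemma fast_rate_zero: "(x, y) \<notin> F \<inter> M \<times> M \<Longrightarrow> fast_rate M N x y = 0"
  by (simp only: fast_rate_def if_False)

lemmas mu_class_facts =
  MM_finite[OF M] MM_ne[OF M] Int_lower2 fast_rate_class fast_rate_zero MM_reach_inside[OF M]

lemma mu_invariant: "N > 0 \<Longrightarrow> invariant_vec M (fast_rate M N) (mu N M)"
  unfolding mu_eq by (rule inv_measure_invariant[where r = "fast_rate M", OF mu_class_facts]) auto

lemma mu_pos: "N > 0 \<Longrightarrow> x \<in> M \<Longrightarrow> 0 < mu N M x"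
  unfolding mu_eq by (rule inv_measure_pos[where r = "fast_rate M", OF mu_class_facts]) auto

lemma mu_outside: "N > 0 \<Longrightarrow> x \<notin> M \<Longrightarrow> mu N M x = 0"
  unfolding mu_eq by (rule inv_measure_outside[where r = "fast_rate M", OF mu_class_facts]) auto

lemma mu_sum: "N > 0 \<Longrightarrow> sum (mu N M) M = 1"
  unfolding mu_eq by (rule inv_measure_sum[where r = "fast_rate M", OF mu_class_facts]) auto

lemma mu_tendsto: "(\<lambda>N. mu N M x) \<longlonglongrightarrow> mu_lim E r M x"
proof -
  have "\<exists>l. (\<lambda>N. mu N M x) \<longlonglongrightarrow> l"
  proof (cases "x \<in> M")
    case True
    have "convergent (\<lambda>N. mu N M x / sum (mu N M) M)"
    proof (rule share_convergent[OF MM_finite[OF M] True mu_pos])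
      show "monomial_like E r 0 (\<lambda>N. mu N M x / sum (mu N M) M)"
        unfolding mu_eq using True
        by (intro inv_measure_share[where r = "fast_rate M", OF mu_class_facts]) auto
    qed
    then obtain l where "(\<lambda>N. mu N M x / sum (mu N M) M) \<longlonglongrightarrow> l"
      by (auto simp: convergent_def)
    then have "(\<lambda>N. mu N M x) \<longlonglongrightarrow> l" by (rule LIMSEQ_cong_pos) (simp add: mu_sum)
    then show ?thesis by blast
  next
    case False
    have "(\<lambda>N. mu N M x) \<longlonglongrightarrow> 0"
      by (rule LIMSEQ_cong_pos[OF tendsto_const]) (simp add: mu_outside False)
    then show ?thesis by blast
  qed
  then show ?thesis unfolding mu_lim_def mu_def by (metis convergentI convergent_LIMSEQ_iff)
qed

lemma mu_lim_outside: "x \<notin> M \<Longrightarrow> mu_lim E r M x = 0"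
  using LIMSEQ_cong_pos[OF mu_tendsto[of x] mu_outside] LIMSEQ_unique[OF tendsto_const] by metis

lemma mu_lim_nonneg: "0 \<le> mu_lim E r M x"
  by (rule LIMSEQ_le_const[OF mu_tendsto]) (simp add: mu_def)

lemma mu_lim_sum: "sum (mu_lim E r M) M = 1"
proof -
  have "(\<lambda>N. sum (mu N M) M) \<longlonglongrightarrow> sum (mu_lim E r M) M" by (intro tendsto_intros mu_tendsto)
  from LIMSEQ_cong_pos[OF this mu_sum] show ?thesis using LIMSEQ_unique[OF tendsto_const] by metis
qed

lemma fast_rate_tendsto:
  assumes "x \<in> M" "y \<in> M"
  shows "(\<lambda>N. fast_rate M N x y / s N) \<longlonglongrightarrow> \<rho> x y"
proof (cases "(x, y) \<in> F")
  case True
  then show ?thesis using \<rho>[of x y] assms by (simp add: fast_rate_def)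
next
  case False
  then show ?thesis by (simp add: fast_rate_def \<rho>_zero)
qed

lemma mu_lim_invariant: "invariant_vec M \<rho> (mu_lim E r M)"
proof (rule balance_from_le[OF MM_finite[OF M]],
    rule limit_balance_le[where k = "fast_rate M", OF mu_tendsto order_refl MM_finite[OF M] _ fast_rate_tendsto])
  show "(\<Sum>x\<in>M. mu N M x * fast_rate M N x y) \<le> mu N M y * (\<Sum>x\<in>M. fast_rate M N y x)"
    if "y \<in> M" "N > 0" for N y
    using mu_invariant[OF that(2)] that(1) by (simp add: invariant_vec_def)
qed

end

text \<open>Some vertex has positive weight since the total is \<open>1\<close>, and positivity
  spreads over \<open>M\<close> by fast edges. This is what turns convergence to
  \<open>mu_lim\<close> into control of relative errors.\<close>

lemma mu_lim_pos:
  assumes M: "M \<in> MM" and x: "x \<in> M"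
  shows "0 < mu_lim E r M x"
proof -
  have "\<exists>x0\<in>M. 0 < mu_lim E r M x0"
  proof (rule ccontr)
    assume "\<not> ?thesis"
    then have "sum (mu_lim E r M) M \<le> 0" by (intro sum_nonpos) (auto simp: not_less)
    then show False using mu_lim_sum[OF M] by simp
  qed
  then obtain x0 where x0: "x0 \<in> M" "0 < mu_lim E r M x0" by blast
  have "(x0, x) \<in> (support_graph M \<rho>)\<^sup>*"
    unfolding support_\<rho> by (rule MM_reach_inside[OF M x0(1) x])
  from invariant_vec_pos[OF MM_finite[OF M] \<rho>_nonneg mu_lim_invariant[OF M] mu_lim_nonneg[OF M] this x0(2)]
  show ?thesis .
qed

abbreviation mass :: "nat \<Rightarrow> 'v set \<Rightarrow> real" where "mass N M \<equiv> sum (st N) M"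

lemma mass_pos:
  assumes "N > 0" "M \<in> MM"
  shows "0 < mass N M"
  using assms MM_sub[of M] by (intro sum_pos MM_finite MM_ne st_pos) auto

text \<open>Dividing by the mass before the limit keeps the argument valid when the mass vanishes in
  the limit. Inflow from outside \<open>M\<close> is dropped, the limiting outflow stays in
  \<open>M\<close> by minimality, and \<open>balance_from_le\<close> restores equality; uniqueness
  then identifies the limit.\<close>

lemma st_share_tendsto:
  assumes M: "M \<in> MM" and x: "x \<in> M"
  shows "(\<lambda>N. st N x / mass N M) \<longlonglongrightarrow> mu_lim E r M x"
proof -
  define q where "q x = lim (\<lambda>N. st N x / mass N M)" for x
  have q: "(\<lambda>N. st N x / mass N M) \<longlonglongrightarrow> q x" if "x \<in> M" for x
    using st_share_convergent[OF MM_sub[OF M] that] unfolding q_def by (simp add: convergent_LIMSEQ_iff)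
  have q0: "0 \<le> q x" if "x \<in> M" for x
    by (rule LIMSEQ_le_const[OF q[OF that]]) (simp add: st_def sum_nonneg)
  have "(\<lambda>N. \<Sum>x\<in>M. st N x / mass N M) \<longlonglongrightarrow> sum q M" by (intro tendsto_intros q)
  moreover have "(\<Sum>x\<in>M. st N x / mass N M) = 1" if "N > 0" for N
    using mass_pos[OF that M] by (simp flip: sum_divide_distrib)
  ultimately have "(\<lambda>N. 1) \<longlonglongrightarrow> sum q M" by (rule LIMSEQ_cong_pos)
  then have q1: "sum q M = 1" using LIMSEQ_unique[OF tendsto_const] by metis
  have inv: "invariant_vec M \<rho> q"
  proof (rule balance_from_le[OF MM_finite[OF M]])
    fix y assume y: "y \<in> M"
    have "(\<Sum>x\<in>M. q x * \<rho> x y) \<le> q y * (\<Sum>x\<in>V. \<rho> y x)"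
    proof (rule limit_balance_le[where k = r and q = "\<lambda>N x. st N x / mass N M", OF q MM_sub[OF M] finV y \<rho>])
      fix N :: nat assume N: "N > 0"
      have yV: "y \<in> V" using y MM_sub[OF M] by blast
      have "(\<Sum>x\<in>M. st N x * r N x y) \<le> (\<Sum>x\<in>V. st N x * r N x y)"
        by (rule sum_mono2[OF finV MM_sub[OF M]]) (simp add: st_def nonneg[OF N])
      also have "\<dots> = st N y * (\<Sum>x\<in>V. r N y x)"
        using st_invariant[OF N] yV by (simp add: invariant_vec_def)
      finally have "(\<Sum>x\<in>M. st N x * r N x y) / mass N M \<le> st N y * (\<Sum>x\<in>V. r N y x) / mass N M"
        using mass_pos[OF N M] by (intro divide_right_mono) auto
      then show "(\<Sum>x\<in>M. st N x / mass N M * r N x y) \<le> st N y / mass N M * (\<Sum>x\<in>V. r N y x)"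
        by (simp add: sum_divide_distrib)
    qed auto
    then show "(\<Sum>x\<in>M. q x * \<rho> x y) \<le> q y * (\<Sum>x\<in>M. \<rho> y x)"
      using sum_\<rho>_closed[OF MM_sub[OF M] MM_closed[OF M y]] by simp
  qed
  have eq: "q x * mu_lim E r M y = q y * mu_lim E r M x" if "y \<in> M" for y
    by (rule invariant_vec_unique[OF MM_finite[OF M] \<rho>_nonneg _ mu_lim_invariant[OF M] mu_lim_pos[OF M] inv q0 x that])
      (simp_all add: support_\<rho> MM_reach_inside[OF M])
  have "q x * sum (mu_lim E r M) M = sum q M * mu_lim E r M x"
    unfolding sum_distrib_left sum_distrib_right by (rule sum.cong) (simp_all add: eq)
  then show ?thesis using q[OF x] by (simp add: q1 mu_lim_sum[OF M])
qed

section \<open>The trace on the minimal classes\<close>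

abbreviation B :: "'v set" where "B \<equiv> V - A"

definition hit :: "nat \<Rightarrow> 'v \<Rightarrow> 'v \<Rightarrow> real" where
  "hit N z y = entrance_prob V (r N) A z y"

lemma sum_V_split: "sum f V = sum f A + sum f B" for f :: "'v \<Rightarrow> real"
  using sum.subset_diff[OF A_sub finV, of f] by (simp add: add.commute)

text \<open>A vertex in \<open>B\<close> guarantees that \<open>V\<close> has two points, so strong
  connectivity gives every vertex an outgoing edge and a positive exit rate.\<close>

lemma jump_rates:
  assumes N: "N > 0" and z: "z \<in> B"
  shows "jump_rates V (r N)"
proof
  fix x assume x: "x \<in> V"
  obtain a where a: "a \<in> A" using A_ne by blast
  obtain x' where x': "x' \<in> V" "x \<noteq> x'" using a z A_sub by (cases "x = a") auto
  obtain u where u: "(x, u) \<in> E" using rtrancl_leave[OF strongly_connected[OF x x'(1)] x'(2)] by blast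
  have "0 < r N x u" using pos[OF N u] .
  also have "r N x u \<le> exit_rate V (r N) x" unfolding exit_rate_def
    by (rule member_le_sum) (use u E_sub finV nonneg[OF N] in auto)
  finally show "0 < exit_rate V (r N) x" .
qed (use finV nonneg[OF N] in auto)

context
  fixes N :: nat assumes N: "N > 0"
begin

lemma hit_nonneg: "0 \<le> hit N z y"
  by (simp add: hit_def entrance_prob_def)

lemma hit_step:
  assumes z: "z \<in> B" and y: "y \<in> A"
  shows "hit N z y * (\<Sum>x\<in>V. r N z x) = r N z y + (\<Sum>x\<in>B. r N z x * hit N x y)"
proof -
  interpret J: jump_rates V "r N" by (rule jump_rates[OF N z])
  have "hit N z y * (\<Sum>x\<in>V. r N z x) = exit_rate V (r N) z * J.entrance A z y"
    using z y by (simp add: hit_def J.entrance_prob_eq exit_rate_def)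
  also have "\<dots> = (\<Sum>x\<in>V. r N z x * J.entrance A x y)" using z y by (intro J.entrance_step) auto
  also have "\<dots> = (\<Sum>x\<in>A. r N z x * J.entrance A x y) + (\<Sum>x\<in>B. r N z x * J.entrance A x y)"
    by (rule sum_V_split)
  also have "(\<Sum>x\<in>A. r N z x * J.entrance A x y) = (\<Sum>x\<in>A. if x = y then r N z x else 0)"
    by (rule sum.cong) (auto simp: J.entrance_inside)
  also have "\<dots> = r N z y" using y finite_A by simp
  also have "(\<Sum>x\<in>B. r N z x * J.entrance A x y) = (\<Sum>x\<in>B. r N z x * hit N x y)"
    by (rule sum.cong) (use y in \<open>auto simp: hit_def J.entrance_prob_eq\<close>)
  finally show ?thesis .
qed

lemma vanish_on_B:
  assumes C: "C \<subseteq> B" and g: "\<And>z. z \<in> C \<Longrightarrow> 0 \<le> g z"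
    and sub: "\<And>z. z \<in> C \<Longrightarrow> g z * (\<Sum>y\<in>V. r N z y) \<le> (\<Sum>x\<in>C. r N z x * g x)"
    and z: "z \<in> C"
  shows "g z = 0"
proof (rule subharmonic_zero[where V = V and B = C and r = "r N", OF finV])
  show "\<exists>y\<in>V - C. (z, y) \<in> (support_graph V (r N))\<^sup>*" if "z \<in> C" for z
  proof -
    obtain a where a: "a \<in> A" using A_ne by blast
    then have "a \<in> V - C" "(z, a) \<in> E\<^sup>*" using A_sub C that strongly_connected by auto
    then show ?thesis unfolding support_graph_rates[OF N] by blast
  qed
qed (use assms nonneg[OF N] in auto)

text \<open>The probability of never entering \<open>A\<close> is harmonic on \<open>B\<close> with
  value \<open>0\<close> imposed on \<open>A\<close>. Its absolute value is subharmonic, so the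
  maximum principle applies without knowing its sign.\<close>

lemma hit_sum:
  assumes z: "z \<in> B"
  shows "(\<Sum>y\<in>A. hit N z y) = 1"
proof -
  define d where "d z = 1 - (\<Sum>y\<in>A. hit N z y)" for z
  have d: "d z * (\<Sum>y\<in>V. r N z y) = (\<Sum>x\<in>B. r N z x * d x)" if z: "z \<in> B" for z
  proof -
    have "(\<Sum>y\<in>A. hit N z y) * (\<Sum>x\<in>V. r N z x) = (\<Sum>y\<in>A. r N z y) + (\<Sum>y\<in>A. \<Sum>x\<in>B. r N z x * hit N x y)"
      unfolding sum_distrib_right by (simp add: hit_step[OF z] sum.distrib)
    also have "(\<Sum>y\<in>A. \<Sum>x\<in>B. r N z x * hit N x y) = (\<Sum>x\<in>B. r N z x * (\<Sum>y\<in>A. hit N x y))"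
      by (subst sum.swap) (simp only: sum_distrib_left)
    also have "\<dots> = (\<Sum>x\<in>B. r N z x) - (\<Sum>x\<in>B. r N z x * d x)"
      by (simp add: d_def right_diff_distrib sum_subtractf)
    finally show ?thesis using sum_V_split[of "r N z"] by (simp add: d_def left_diff_distrib)
  qed
  have "\<bar>d z\<bar> = 0"
  proof (rule vanish_on_B[where C = B])
    show "\<bar>d z\<bar> * (\<Sum>y\<in>V. r N z y) \<le> (\<Sum>x\<in>B. r N z x * \<bar>d x\<bar>)" if "z \<in> B" for z
    proof -
      have "\<bar>d z\<bar> * (\<Sum>y\<in>V. r N z y) = \<bar>\<Sum>x\<in>B. r N z x * d x\<bar>"
        unfolding d[OF that, symmetric] by (simp add: abs_mult sum_nonneg nonneg[OF N])
      also have "\<dots> \<le> (\<Sum>x\<in>B. \<bar>r N z x * d x\<bar>)" by (rule sum_abs)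
      also have "\<dots> = (\<Sum>x\<in>B. r N z x * \<bar>d x\<bar>)" by (simp add: abs_mult nonneg[OF N])
      finally show ?thesis .
    qed
  qed (use z in auto)
  then show ?thesis by (simp add: d_def)
qed

end

text \<open>This is the set of \<open>z\<close> with positive \<open>hit N z y\<close>. It does not
  depend on \<open>N\<close>, as the fixed graph in the elimination theorem requires.\<close>

definition entering :: "'v \<Rightarrow> 'v set" where
  "entering y = {z \<in> B. \<exists>z'\<in>B. (z, z') \<in> (E \<inter> B \<times> B)\<^sup>* \<and> (z', y) \<in> E}"

lemma hit_pos:
  assumes N: "N > 0" and z: "z \<in> entering y" and y: "y \<in> A"
  shows "0 < hit N z y"
proof -
  have term0: "0 \<le> r N a b * hit N b y" for a b using nonneg[OF N] hit_nonneg[OF N] by simp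
  have fB: "finite B" using finV by simp
  have posI: "0 < hit N z y" if z: "z \<in> B" and "0 < r N z y + (\<Sum>x\<in>B. r N z x * hit N x y)" for z
    using that(2) hit_nonneg[OF N, of z y] unfolding hit_step[OF N z y, symmetric]
    by (cases "hit N z y = 0") auto
  obtain z' where z': "z' \<in> B" "(z, z') \<in> (E \<inter> B \<times> B)\<^sup>*" "(z', y) \<in> E" using z by (auto simp: entering_def)
  from z'(2) show ?thesis
  proof (induction rule: converse_rtrancl_induct)
    case base
    show ?case by (rule posI[OF z'(1)]) (use pos[OF N z'(3)] term0 in \<open>simp add: add_pos_nonneg sum_nonneg\<close>)
  next
    case (step a b)
    then have ab: "a \<in> B" "b \<in> B" "(a, b) \<in> E" by auto
    have "0 < r N a b * hit N b y" using pos[OF N ab(3)] step.IH by simp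
    also have "\<dots> \<le> (\<Sum>x\<in>B. r N a x * hit N x y)" by (rule member_le_sum[OF ab(2)]) (use term0 fB in auto)
    finally show ?case using nonneg[OF N, of a y] by (intro posI[OF ab(1)]) simp
  qed
qed

text \<open>From outside \<open>entering y\<close> no edge leads to \<open>y\<close> or to a vertex
  of \<open>entering y\<close>, so the one-step equation closes up on the rest of \<open>B\<close>
  and the maximum principle applies there.\<close>

lemma hit_zero:
  assumes N: "N > 0" and z: "z \<in> B" "z \<notin> entering y" and y: "y \<in> A"
  shows "hit N z y = 0"
proof (rule vanish_on_B[OF N, where C = "B - entering y" and g = "\<lambda>z. hit N z y"])
  fix z assume z: "z \<in> B - entering y"
  have no_edge: "r N z x = 0" if "x \<in> B \<inter> entering y" for x
  proof (rule ccontr)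
    assume "r N z x \<noteq> 0"
    then have "(z, x) \<in> E \<inter> B \<times> B" using zero[OF N] z that by blast
    then have "z \<in> entering y" using that z by (auto simp: entering_def intro: converse_rtrancl_into_rtrancl)
    then show False using z by blast
  qed
  have "(z, y) \<notin> E" using z by (auto simp: entering_def)
  then have "hit N z y * (\<Sum>x\<in>V. r N z x) = (\<Sum>x\<in>B. r N z x * hit N x y)"
    using hit_step[OF N _ y, of z] z zero[OF N] by simp
  also have "\<dots> = (\<Sum>x\<in>B - entering y. r N z x * hit N x y)"
    by (rule sum.mono_neutral_right) (use finV no_edge in auto)
  finally show "hit N z y * (\<Sum>x\<in>V. r N z x) \<le> (\<Sum>x\<in>B - entering y. r N z x * hit N x y)" by simp
qed (use z hit_nonneg[OF N] in auto)

text \<open>In contrast to \<open>trace_rate\<close> the diagonal is kept: excursions returning to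
  their starting point are counted, and total exit rates stay those of the original chain.\<close>

definition trace :: "nat \<Rightarrow> 'v \<Rightarrow> 'v \<Rightarrow> real" where
  "trace N x y = r N x y + (\<Sum>z\<in>B. r N x z * hit N z y)"

lemma trace_rate_eq: "x \<noteq> y \<Longrightarrow> trace_rate V (r N) A x y = trace N x y"
  by (simp add: trace_rate_def trace_def hit_def)

lemma trace_row:
  assumes N: "N > 0"
  shows "(\<Sum>y\<in>A. trace N x y) = (\<Sum>y\<in>V. r N x y)"
proof -
  have "(\<Sum>y\<in>A. \<Sum>z\<in>B. r N x z * hit N z y) = (\<Sum>z\<in>B. r N x z * (\<Sum>y\<in>A. hit N z y))"
    by (subst sum.swap) (simp only: sum_distrib_left)
  also have "\<dots> = (\<Sum>z\<in>B. r N x z)" by (rule sum.cong) (simp_all add: hit_sum[OF N])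
  finally show ?thesis by (simp add: trace_def sum.distrib sum_V_split[of "r N x"])
qed

text \<open>Weight the balance equation at each \<open>z\<close> in \<open>B\<close> with
  \<open>hit N z y\<close> and sum. By \<open>hit_step\<close> the flow circulating in
  \<open>B\<close> appears on both sides; what remains equates the flow from \<open>B\<close> into
  \<open>y\<close> with the flow leaving \<open>A\<close> for \<open>B\<close> and returning at
  \<open>y\<close>.\<close>

lemma trace_balance:
  assumes N: "N > 0" and y: "y \<in> A"
  shows "st N y * (\<Sum>x\<in>A. trace N y x) = (\<Sum>x\<in>A. st N x * trace N x y)"
proof -
  let ?R = "\<lambda>z. \<Sum>x\<in>V. r N z x"
  have bal: "st N x * ?R x = (\<Sum>u\<in>A. st N u * r N u x) + (\<Sum>u\<in>B. st N u * r N u x)" if "x \<in> V" for x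
    using st_invariant[OF N] that sum_V_split[of "\<lambda>u. st N u * r N u x"] by (simp add: invariant_vec_def)
  have "(\<Sum>z\<in>B. st N z * ?R z * hit N z y) =
      (\<Sum>z\<in>B. (\<Sum>u\<in>A. st N u * r N u z) * hit N z y) + (\<Sum>z\<in>B. (\<Sum>u\<in>B. st N u * r N u z) * hit N z y)"
    unfolding sum.distrib[symmetric] distrib_right[symmetric] by (rule sum.cong) (simp_all add: bal)
  also have "(\<Sum>z\<in>B. (\<Sum>u\<in>B. st N u * r N u z) * hit N z y) =
      (\<Sum>u\<in>B. st N u * (\<Sum>z\<in>B. r N u z * hit N z y))"
    unfolding sum_distrib_right sum_distrib_left by (subst sum.swap) (simp only: mult.assoc)
  also have "(\<Sum>z\<in>B. (\<Sum>u\<in>A. st N u * r N u z) * hit N z y) =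
      (\<Sum>u\<in>A. st N u * (\<Sum>z\<in>B. r N u z * hit N z y))"
    unfolding sum_distrib_right sum_distrib_left by (subst sum.swap) (simp only: mult.assoc)
  finally have 1: "(\<Sum>z\<in>B. st N z * ?R z * hit N z y) =
      (\<Sum>u\<in>A. st N u * (\<Sum>z\<in>B. r N u z * hit N z y)) + (\<Sum>u\<in>B. st N u * (\<Sum>z\<in>B. r N u z * hit N z y))" .
  have "(\<Sum>z\<in>B. st N z * ?R z * hit N z y) = (\<Sum>z\<in>B. st N z * (hit N z y * ?R z))"
    by (rule sum.cong) simp_all
  also have "\<dots> = (\<Sum>z\<in>B. st N z * r N z y) + (\<Sum>u\<in>B. st N u * (\<Sum>z\<in>B. r N u z * hit N z y))"
    unfolding sum.distrib[symmetric] distrib_left[symmetric] by (rule sum.cong) (simp_all add: hit_step[OF N _ y])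
  finally have "(\<Sum>z\<in>B. st N z * r N z y) = (\<Sum>u\<in>A. st N u * (\<Sum>z\<in>B. r N u z * hit N z y))"
    using 1 by simp
  moreover have "st N y * (\<Sum>x\<in>A. trace N y x) = (\<Sum>u\<in>A. st N u * r N u y) + (\<Sum>u\<in>B. st N u * r N u y)"
    unfolding trace_row[OF N] using bal y A_sub by blast
  ultimately show ?thesis by (simp add: trace_def distrib_left sum.distrib)
qed

definition trace_graph :: "('v \<times> 'v) set" where
  "trace_graph = {(x, y) \<in> A \<times> A. (x, y) \<in> E \<or> (\<exists>z\<in>entering y. (x, z) \<in> E)}"

lemma trace_pos:
  assumes N: "N > 0" and xy: "(x, y) \<in> trace_graph"
  shows "0 < trace N x y"
proof -
  have y: "y \<in> A" using xy by (auto simp: trace_graph_def)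
  have fB: "finite B" using finV by simp
  have term0: "0 \<le> r N x z * hit N z y" for z using nonneg[OF N] hit_nonneg[OF N] by simp
  from xy consider "(x, y) \<in> E" | z where "z \<in> entering y" "(x, z) \<in> E" by (auto simp: trace_graph_def)
  then show ?thesis
  proof cases
    case 1
    then show ?thesis using pos[OF N] term0 by (simp add: trace_def add_pos_nonneg sum_nonneg)
  next
    case 2
    then have "0 < r N x z * hit N z y" using pos[OF N] hit_pos[OF N _ y] by simp
    also have "\<dots> \<le> (\<Sum>z\<in>B. r N x z * hit N z y)"
      by (rule member_le_sum) (use 2 fB term0 in \<open>auto simp: entering_def\<close>)
    finally show ?thesis using nonneg[OF N, of x y] by (simp add: trace_def)
  qed
qed

lemma trace_zero:
  assumes N: "N > 0" and xy: "x \<in> A" "y \<in> A" "(x, y) \<notin> trace_graph"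
  shows "trace N x y = 0"
proof -
  have "r N x z * hit N z y = 0" if "z \<in> B" for z
  proof (cases "z \<in> entering y")
    case True
    then show ?thesis using xy zero[OF N] by (auto simp: trace_graph_def)
  next
    case False
    then show ?thesis using hit_zero[OF N that _ xy(2)] by simp
  qed
  then have "(\<Sum>z\<in>B. r N x z * hit N z y) = 0" by (intro sum.neutral) blast
  then show ?thesis using xy zero[OF N] by (simp add: trace_def trace_graph_def)
qed

text \<open>While the path is inside \<open>B\<close>, the induction remembers the vertex
  \<open>u\<close> where \<open>A\<close> was left and the first vertex \<open>z\<close> of the
  excursion; on return the excursion becomes one edge.\<close>

lemma trace_graph_connected:
  assumes "x \<in> A" "y \<in> A"
  shows "(x, y) \<in> trace_graph\<^sup>*"
proof -
  have "(x, y) \<in> E\<^sup>*" using assms A_sub strongly_connected by blast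
  then have "(y \<in> A \<longrightarrow> (x, y) \<in> trace_graph\<^sup>*) \<and>
      (y \<in> B \<longrightarrow> (\<exists>u\<in>A. \<exists>z\<in>B. (x, u) \<in> trace_graph\<^sup>* \<and> (u, z) \<in> E \<and> (z, y) \<in> (E \<inter> B \<times> B)\<^sup>*))"
  proof (induction rule: rtrancl_induct)
    case base
    then show ?case using assms by simp
  next
    case (step v v')
    then have V: "v \<in> V" "v' \<in> V" using E_sub by auto
    show ?case
    proof (cases "v \<in> A")
      case True
      then have v: "(x, v) \<in> trace_graph\<^sup>*" using step.IH by blast
      have "(v, v') \<in> trace_graph" if "v' \<in> A" using step.hyps(2) that True by (simp add: trace_graph_def)
      then show ?thesis using v True step.hyps(2) by (meson DiffD2 rtrancl.simps)
    next
      case False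
      then obtain u z where u: "u \<in> A" "z \<in> B" "(x, u) \<in> trace_graph\<^sup>*" "(u, z) \<in> E" "(z, v) \<in> (E \<inter> B \<times> B)\<^sup>*"
        using step.IH V by blast
      show ?thesis
      proof (cases "v' \<in> A")
        case True
        have "z \<in> entering v'" using u(2,5) False V step.hyps(2) by (auto simp: entering_def)
        then have "(u, v') \<in> trace_graph" using u True by (auto simp: trace_graph_def)
        then show ?thesis using u(3) True by (meson DiffD2 rtrancl.rtrancl_into_rtrancl)
      next
        case v': False
        have "(v, v') \<in> E \<inter> B \<times> B" using False v' V step.hyps(2) by blast
        then have "(z, v') \<in> (E \<inter> B \<times> B)\<^sup>*" using u(5) by (rule rtrancl_into_rtrancl[rotated])
        then show ?thesis using u v' by blast
      qed
    qed
  qed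
  then show ?thesis using assms by blast
qed

section \<open>Lumping the trace chain\<close>

text \<open>The law inside each class is a parameter: \<open>share\<close> yields the exact lumping
  of the stationary flow, \<open>mu\<close> the effective rates.\<close>

definition lump :: "nat \<Rightarrow> ('v set \<Rightarrow> 'v \<Rightarrow> real) \<Rightarrow> 'v set \<Rightarrow> 'v set \<Rightarrow> real" where
  "lump N q M M' = (if M = M' then 0 else \<Sum>x\<in>M. \<Sum>y\<in>M'. q M x * trace N x y)"

definition share :: "nat \<Rightarrow> 'v set \<Rightarrow> 'v \<Rightarrow> real" where
  "share N M x = st N x / mass N M"

definition lump_graph :: "('v set \<times> 'v set) set" where
  "lump_graph = {(M, M') \<in> MM \<times> MM. M \<noteq> M' \<and> (\<exists>x\<in>M. \<exists>y\<in>M'. (x, y) \<in> trace_graph)}"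

lemma in_A: "M \<in> MM \<Longrightarrow> x \<in> M \<Longrightarrow> x \<in> A"
  unfolding V_hat_def by blast

lemma eff_rate_eq:
  assumes "M \<in> MM" "M' \<in> MM"
  shows "eff_rate V E r N M M' = lump N (mu N) M M'"
proof (cases "M = M'")
  case False
  then have "x \<noteq> y" if "x \<in> M" "y \<in> M'" for x y using MM_disjoint[OF assms] that by blast
  then show ?thesis using False
    unfolding eff_rate_def lump_def mu_def by (auto simp: trace_rate_eq intro!: sum.cong)
qed (simp add: eff_rate_def lump_def)

lemma lump_graph_connected:
  assumes M: "M \<in> MM" "M' \<in> MM"
  shows "(M, M') \<in> lump_graph\<^sup>*"
proof -
  obtain x y where xy: "x \<in> M" "y \<in> M'" using MM_ne M by blast
  have "(x, y) \<in> trace_graph\<^sup>*" using trace_graph_connected in_A M xy by blast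
  then have "\<forall>M'\<in>MM. y \<in> M' \<longrightarrow> (M, M') \<in> lump_graph\<^sup>*"
  proof (induction rule: rtrancl_induct)
    case base
    then show ?case using MM_disjoint M xy by blast
  next
    case (step y z)
    show ?case
    proof (intro ballI impI)
      fix M'' assume M'': "M'' \<in> MM" "z \<in> M''"
      have "y \<in> A" using step.hyps(2) by (auto simp: trace_graph_def)
      then obtain M' where M': "M' \<in> MM" "y \<in> M'" unfolding V_hat_def by blast
      then have "(M, M') \<in> lump_graph\<^sup>*" using step.IH by blast
      moreover have "(M', M'') \<in> lump_graph" if "M' \<noteq> M''"
        using that M' M'' step.hyps(2) by (auto simp: lump_graph_def)
      ultimately show "(M, M'') \<in> lump_graph\<^sup>*"
        by (cases "M' = M''") (auto intro: rtrancl_into_rtrancl)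
    qed
  qed
  then show ?thesis using M xy by blast
qed

lemma sum_off_diagonal:
  fixes f :: "'b \<Rightarrow> real"
  assumes "finite S" "M \<in> S"
  shows "(\<Sum>M'\<in>S. if M = M' then 0 else f M') = sum f S - f M"
proof -
  have "(\<Sum>M'\<in>S. if M = M' then 0 else f M') = (\<Sum>M'\<in>S. f M' - (if M = M' then f M' else 0))"
    by (rule sum.cong) auto
  then show ?thesis using assms by (simp add: sum_subtractf)
qed

text \<open>Mass times \<open>share\<close> is \<open>st\<close>, so lumped rates weighted by mass
  are stationary flows between classes. Summing \<open>trace_balance\<close> over a class and
  removing the internal flow from both sides gives exact invariance for each
  \<open>N\<close>.\<close>

lemma mass_invariant:
  assumes N: "N > 0"
  shows "invariant_vec MM (lump N (share N)) (mass N)"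
  unfolding invariant_vec_def
proof
  fix M assume M: "M \<in> MM"
  define flow where "flow M M' = (\<Sum>x\<in>M. \<Sum>y\<in>M'. st N x * trace N x y)" for M M'
  have wl: "mass N M * lump N (share N) M M' = (if M = M' then 0 else flow M M')" if "M \<in> MM" for M M'
    using mass_pos[OF N that] unfolding lump_def flow_def share_def
    by (simp add: sum_distrib_left mult.assoc[symmetric])
  have "mass N M * (\<Sum>M'\<in>MM. lump N (share N) M M') = (\<Sum>M'\<in>MM. if M = M' then 0 else flow M M')"
    unfolding sum_distrib_left by (simp only: wl[OF M])
  also have "\<dots> = (\<Sum>M'\<in>MM. flow M M') - flow M M" by (rule sum_off_diagonal[OF finite_MM M])
  also have "(\<Sum>M'\<in>MM. flow M M') = (\<Sum>x\<in>M. st N x * (\<Sum>y\<in>A. trace N x y))"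
    unfolding flow_def sum_A sum_distrib_left by (rule sum.swap)
  also have "\<dots> = (\<Sum>y\<in>M. \<Sum>x\<in>A. st N x * trace N x y)"
    by (rule sum.cong) (simp_all add: trace_balance[OF N in_A[OF M]])
  also have "\<dots> = (\<Sum>M'\<in>MM. \<Sum>y\<in>M. \<Sum>x\<in>M'. st N x * trace N x y)"
    unfolding sum_A by (rule sum.swap)
  also have "\<dots> = (\<Sum>M'\<in>MM. flow M' M)" unfolding flow_def by (rule sum.cong[OF refl], rule sum.swap)
  also have "\<dots> - flow M M = (\<Sum>M'\<in>MM. if M = M' then 0 else flow M' M)"
    by (rule sum_off_diagonal[OF finite_MM M, symmetric])
  also have "\<dots> = (\<Sum>M'\<in>MM. mass N M' * lump N (share N) M' M)"
    by (rule sum.cong) (auto simp: wl)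
  finally show "mass N M * (\<Sum>M'\<in>MM. lump N (share N) M M') = (\<Sum>M'\<in>MM. mass N M' * lump N (share N) M' M)" .
qed

section \<open>Comparison with the effective rates\<close>

definition pair_share :: "nat \<times> bool \<Rightarrow> 'v set \<Rightarrow> 'v \<Rightarrow> real" where
  "pair_share i = (if snd i then share (fst i) else mu (fst i))"

definition pair_rate :: "nat \<times> bool \<Rightarrow> 'v set \<Rightarrow> 'v set \<Rightarrow> real" where
  "pair_rate i = lump (fst i) (pair_share i)"

text \<open>The conditional law (\<open>True\<close>) and \<open>mu\<close> (\<open>False\<close>)
  have the same limit; as it is positive, their quotient tends to \<open>1\<close>.\<close>

lemma equiv_pair_share:
  assumes M: "M \<in> MM" and x: "x \<in> M"
  shows "equiv_pair 0 (\<lambda>i. pair_share i M x)"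
  unfolding equiv_pair_def
proof (intro conjI allI impI)
  show "0 < pair_share (N, b) M x" if "0 < N" for N b
    using that mass_pos[OF that M] st_pos[OF that] mu_pos[OF M that x] MM_sub[OF M] x
    by (auto simp: pair_share_def share_def)
  have "(\<lambda>N. share N M x / mu N M x) \<longlonglongrightarrow> mu_lim E r M x / mu_lim E r M x"
    unfolding share_def
    by (rule tendsto_divide[OF st_share_tendsto[OF M x] mu_tendsto[OF M]]) (use mu_lim_pos[OF M x] in simp)
  then show "(\<lambda>N. pair_share (N, True) M x / pair_share (N, False) M x) \<longlonglongrightarrow> 1"
    using mu_lim_pos[OF M x] by (simp add: pair_share_def)
qed

lemma equiv_pair_trace:
  assumes "(x, y) \<in> trace_graph"
  shows "equiv_pair 1 (\<lambda>i. trace (fst i) x y)"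
  unfolding equiv_pair_def
proof (intro conjI allI impI)
  show "(\<lambda>N. trace (fst (N, True)) x y / trace (fst (N, False)) x y) \<longlonglongrightarrow> 1"
    by (rule LIMSEQ_cong_pos[OF tendsto_const]) (use trace_pos[OF _ assms] in \<open>simp add: less_imp_neq[symmetric]\<close>)
qed (use trace_pos assms in simp)

lemma pair_rate_class:
  assumes "(M, M') \<in> lump_graph"
  shows "equiv_pair 1 (\<lambda>i. pair_rate i M M')"
proof -
  have M: "M \<in> MM" "M' \<in> MM" "M \<noteq> M'" and ne: "trace_graph \<inter> M \<times> M' \<noteq> {}"
    using assms by (auto simp: lump_graph_def)
  have "equiv_pair 1 (\<lambda>i. \<Sum>e\<in>M \<times> M'. pair_share i M (fst e) * trace (fst i) (fst e) (snd e))"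
  proof (rule equiv_pair.K_sum_zero[OF _ Int_lower2 ne])
    show "finite (M \<times> M')" using M MM_finite by simp
    show "equiv_pair 1 (\<lambda>i. pair_share i M (fst e) * trace (fst i) (fst e) (snd e))"
      if "e \<in> trace_graph \<inter> M \<times> M'" for e
      using equiv_pair.K_mult[OF equiv_pair_share[OF M(1)] equiv_pair_trace, of "fst e" "fst e" "snd e"] that
      by auto
    show "pair_share i M (fst e) * trace (fst i) (fst e) (snd e) = 0"
      if "i \<in> {N. N > 0} \<times> UNIV" "e \<in> M \<times> M' - trace_graph \<inter> M \<times> M'" for i e
      using that M in_A by (auto simp: trace_zero)
  qed
  then show ?thesis
    by (rule equiv_pair.K_cong) (simp add: pair_rate_def lump_def M(3) sum.cartesian_product case_prod_unfold)
qed

lemma pair_rate_zero: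
  assumes "i \<in> {N. N > 0} \<times> UNIV" "M \<in> MM" "M' \<in> MM" "(M, M') \<notin> lump_graph"
  shows "pair_rate i M M' = 0"
proof (cases "M = M'")
  case False
  have "trace (fst i) x y = 0" if "x \<in> M" "y \<in> M'" for x y
  proof (rule trace_zero)
    show "0 < fst i" using assms(1) by auto
    show "x \<in> A" "y \<in> A" using in_A assms(2,3) that by blast+
    show "(x, y) \<notin> trace_graph" using assms False that by (auto simp: lump_graph_def)
  qed
  then show ?thesis by (simp add: pair_rate_def lump_def)
qed (simp add: pair_rate_def lump_def)

lemma lump_graph_sub: "lump_graph \<subseteq> MM \<times> MM" by (auto simp: lump_graph_def)

lemmas pair_class_facts =
  finite_MM MM_ne' lump_graph_sub pair_rate_class pair_rate_zero lump_graph_connected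

definition pair_measure :: "nat \<times> bool \<Rightarrow> 'v set \<Rightarrow> real" where
  "pair_measure i = pmf (inv_measure MM (pair_rate i))"

lemma pair_measure_pos: "N > 0 \<Longrightarrow> M \<in> MM \<Longrightarrow> 0 < pair_measure (N, b) M"
  unfolding pair_measure_def by (rule equiv_pair.inv_measure_pos[where r = pair_rate, OF pair_class_facts]) auto

lemma pair_measure_sum: "N > 0 \<Longrightarrow> sum (pair_measure (N, b)) MM = 1"
  unfolding pair_measure_def by (rule equiv_pair.inv_measure_sum[where r = pair_rate, OF pair_class_facts]) auto

lemma pair_measure_share: "M \<in> MM \<Longrightarrow> equiv_pair 0 (\<lambda>i. pair_measure i M / sum (pair_measure i) MM)"
  unfolding pair_measure_def
  by (rule equiv_pair.inv_measure_share[where r = pair_rate, OF pair_class_facts _ order_refl MM_ne'])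

lemma pair_measure_ratio:
  assumes "M \<in> MM"
  shows "(\<lambda>N. pair_measure (N, True) M / pair_measure (N, False) M) \<longlonglongrightarrow> 1"
proof (rule LIMSEQ_cong_pos)
  show "(\<lambda>N. (pair_measure (N, True) M / sum (pair_measure (N, True)) MM) / (pair_measure (N, False) M / sum (pair_measure (N, False)) MM)) \<longlonglongrightarrow> 1"
    using pair_measure_share[OF assms] by (simp add: equiv_pair_def)
qed (simp add: pair_measure_sum)

text \<open>The masses of the classes sum to \<open>mass N A\<close>, which can be less than
  \<open>1\<close> because \<open>st N\<close> also charges \<open>B\<close>.\<close>

lemma pair_measure_True:
  assumes N: "N > 0" and M: "M \<in> MM"
  shows "pair_measure (N, True) M = mass N M / mass N A"
proof -
  let ?k = "pair_rate (N, True)"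
  have pos: "0 < ?k M M'" if "(M, M') \<in> lump_graph" for M M'
    using equiv_pair.K_pos[OF pair_rate_class[OF that], of "(N, True)"] N by simp
  have zero: "?k M M' = 0" if "M \<in> MM" "M' \<in> MM" "(M, M') \<notin> lump_graph" for M M'
    using pair_rate_zero[OF _ that] N by simp
  have "support_graph MM ?k = lump_graph"
    using pos zero lump_graph_sub unfolding support_graph_def by (auto, metis less_irrefl)
  then have irr: "(M, M') \<in> (support_graph MM ?k)\<^sup>*" if "M \<in> MM" "M' \<in> MM" for M M'
    using lump_graph_connected[OF that] by simp
  have nonneg: "0 \<le> ?k M M'" if "M \<in> MM" "M' \<in> MM" for M M'
    using pos[of M M'] zero[OF that] by (cases "(M, M') \<in> lump_graph") (auto intro: less_imp_le)
  have "pair_measure (N, True) M = (if M \<in> MM then mass N M / sum (mass N) MM else 0)"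
    unfolding pair_measure_def
  proof (rule pmf_inv_measure[OF finite_MM MM_ne' nonneg irr])
    show "invariant_vec MM ?k (mass N)"
      using mass_invariant[OF N] by (simp add: pair_rate_def pair_share_def)
  qed (use mass_pos[OF N] in auto)
  then show ?thesis using M by (simp add: sum_A)
qed

text \<open>\<open>inv_measure\<close> sees the rates only between members of \<open>MM\<close>,
  where \<open>pair_rate (N, False)\<close> agrees with \<open>eff_rate\<close>.\<close>

lemma pair_measure_False:
  shows "pair_measure (N, False) = pmf (pi_bar_N V E r N)"
proof -
  have "inv_measure MM (pair_rate (N, False)) = inv_measure MM (eff_rate V E r N)"
    unfolding inv_measure_def invariant_pmf_def pair_rate_def pair_share_def
    by (simp add: eff_rate_eq cong: ball_cong sum.cong)
  then show ?thesis by (simp add: pair_measure_def pi_bar_N_def)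
qed

section \<open>Identification of the limit\<close>

lemma sum_st_lim_A: "sum st_lim A = 1"
  using st_lim_sum sum_V_split[of st_lim] st_lim_outside by simp

text \<open>The normalising mass of \<open>A\<close> tends to \<open>1\<close>, and a quotient
  tending to \<open>1\<close> carries the limit of the exact masses over to the effective chain,
  even when that limit is \<open>0\<close>.\<close>

lemma pi_bar_lim_eq:
  assumes M: "M \<in> MM"
  shows "pi_bar_lim V E r M = sum st_lim M"
proof -
  have "(\<lambda>N. mass N M / mass N A) \<longlonglongrightarrow> sum st_lim M / sum st_lim A"
    by (intro tendsto_intros st_tendsto) (simp add: sum_st_lim_A)
  then have "(\<lambda>N. mass N M / mass N A) \<longlonglongrightarrow> sum st_lim M" by (simp add: sum_st_lim_A)
  then have "(\<lambda>N. pair_measure (N, True) M) \<longlonglongrightarrow> sum st_lim M"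
    by (rule LIMSEQ_cong_pos) (simp add: pair_measure_True M)
  from tendsto_divide[OF this pair_measure_ratio[OF M]]
  have "(\<lambda>N. pair_measure (N, True) M / (pair_measure (N, True) M / pair_measure (N, False) M)) \<longlonglongrightarrow> sum st_lim M" by simp
  then have "(\<lambda>N. pair_measure (N, False) M) \<longlonglongrightarrow> sum st_lim M"
    by (rule LIMSEQ_cong_pos) (use pair_measure_pos[OF _ M] in \<open>simp add: less_imp_neq[symmetric]\<close>)
  then show ?thesis unfolding pi_bar_lim_def pair_measure_False by (rule limI)
qed

lemma st_lim_on_class:
  assumes M: "M \<in> MM" and x: "x \<in> M"
  shows "st_lim x = pi_bar_lim V E r M * mu_lim E r M x"
proof -
  have "(\<lambda>N. mass N M * (st N x / mass N M)) \<longlonglongrightarrow> sum st_lim M * mu_lim E r M x"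
    by (intro tendsto_intros st_tendsto st_share_tendsto[OF M x])
  then have "(\<lambda>N. st N x) \<longlonglongrightarrow> sum st_lim M * mu_lim E r M x"
    by (rule LIMSEQ_cong_pos) (use mass_pos[OF _ M] in \<open>simp add: less_imp_neq[symmetric]\<close>)
  then show ?thesis
    unfolding pi_bar_lim_eq[OF M] using LIMSEQ_unique[OF st_tendsto] by blast
qed

lemma st_lim_mixture: "st_lim x = (\<Sum>M\<in>MM. pi_bar_lim V E r M * mu_lim E r M x)"
proof (cases "x \<in> A")
  case True
  then obtain M where M: "M \<in> MM" "x \<in> M" unfolding V_hat_def by blast
  have "(\<Sum>M\<in>MM. pi_bar_lim V E r M * mu_lim E r M x) =
      (\<Sum>M'\<in>{M}. pi_bar_lim V E r M' * mu_lim E r M' x)"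
  proof (rule sum.mono_neutral_right[OF finite_MM])
    show "\<forall>M'\<in>MM - {M}. pi_bar_lim V E r M' * mu_lim E r M' x = 0"
      using MM_disjoint[OF M(1)] M(2) mu_lim_outside by fastforce
  qed (use M in simp)
  then show ?thesis using st_lim_on_class[OF M] by simp
next
  case False
  then have "mu_lim E r M x = 0" if "M \<in> MM" for M using mu_lim_outside[OF that] in_A[OF that] by blast
  then show ?thesis using st_lim_outside[OF False] by simp
qed

lemma nonminimal_outside:
  assumes M: "M \<in> fast_classes V E r - MM" and x: "x \<in> M"
  shows "x \<notin> A"
proof
  assume "x \<in> A"
  then obtain M' where M': "M' \<in> MM" "x \<in> M'" unfolding V_hat_def by blast
  have "M = M' \<or> M \<inter> M' = {}"
    using M by (intro quotient_disj[OF equiv_class_rel _ MM_fast_class[OF M'(1)]]) (simp add: fast_classes_eq)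
  then show False using M M' x by blast
qed

end

theorem theorem2p7:
  fixes V :: "'v set" and E :: "('v \<times> 'v) set" and r :: "nat \<Rightarrow> 'v \<Rightarrow> 'v \<Rightarrow> real"
  assumes "finite V" and "V \<noteq> {}" and "E \<subseteq> V \<times> V"
    and strongly_connected: "\<And>x y. x \<in> V \<Longrightarrow> y \<in> V \<Longrightarrow> (x, y) \<in> E\<^sup>*"
    and rate_pos: "\<And>N x y. N > 0 \<Longrightarrow> (x, y) \<in> E \<Longrightarrow> r N x y > 0"
    and rate_zero: "\<And>N x y. N > 0 \<Longrightarrow> (x, y) \<notin> E \<Longrightarrow> r N x y = 0"
    and "assumption_A E r"
  shows "\<exists>\<pi> :: 'v pmf.
    set_pmf \<pi> \<subseteq> V \<and>
    (\<forall>x. (\<lambda>N. pmf (inv_measure V (r N)) x) \<longlonglongrightarrow> pmf \<pi> x) \<and>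
    (\<forall>x. pmf \<pi> x = (\<Sum>M\<in>minimal_classes V E r. pi_bar_lim V E r M * mu_lim E r M x)) \<and>
    (\<forall>x \<in> V - V_hat V E r. pmf \<pi> x = 0) \<and>
    (\<forall>M \<in> minimal_classes V E r. \<forall>x\<in>M. pmf \<pi> x = pi_bar_lim V E r M * mu_lim E r M x) \<and>
    (\<forall>M \<in> fast_classes V E r - minimal_classes V E r. \<forall>x\<in>M. pmf \<pi> x = 0)"
proof -
  interpret rate_family V E r by unfold_locales (fact assms)+
  have P: "pmf (embed_pmf st_lim) x = st_lim x" for x
    by (rule pmf_embed_finite[OF finV st_lim_nonneg st_lim_outside_V st_lim_sum])
  show ?thesis
  proof (intro exI[of _ "embed_pmf st_lim"] conjI allI ballI)
    show "set_pmf (embed_pmf st_lim) \<subseteq> V" using st_lim_outside_V by (auto simp: set_pmf_eq P)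
    show "(\<lambda>N. pmf (inv_measure V (r N)) x) \<longlonglongrightarrow> pmf (embed_pmf st_lim) x" for x
      using st_tendsto[of x] by (simp add: P st_def)
    show "pmf (embed_pmf st_lim) x = (\<Sum>M\<in>MM. pi_bar_lim V E r M * mu_lim E r M x)" for x
      unfolding P by (rule st_lim_mixture)
    show "pmf (embed_pmf st_lim) x = 0" if "x \<in> V - A" for x
      using that by (simp add: P st_lim_outside)
    show "pmf (embed_pmf st_lim) x = pi_bar_lim V E r M * mu_lim E r M x" if "M \<in> MM" "x \<in> M" for M x
      unfolding P using that by (rule st_lim_on_class)
    show "pmf (embed_pmf st_lim) x = 0" if "M \<in> fast_classes V E r - MM" "x \<in> M" for M x
      unfolding P using nonminimal_outside[OF that] by (rule st_lim_outside)
  qed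
qed

end
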